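(* Let $\ell\in\mathbb N$. 1) The determinants $\mathcal P_{\ell,\pm}(\chi,a,s)=\det(G_{1,\ell}\pm G_{2,\ell})$ are irreducible polynomials in $(\chi,a,s)$ (over $\mathbb C$) that are obtained one from the other by the sign change of two variables $(\chi,a)\mapsto(-\chi,-a)$. 2) Their zero loci $$S_{\ell,\pm}:=\{\mathcal P_{\ell,\pm}(\chi,a,s)=0\}\subset\mathbb C^3_{\chi,a,s}$$ are irreducible affine surfaces permuted by the involution $\mathcal I:(\chi,a,s)\mapsto(-\chi,-a,s)$.
   Context: $\mathbb N=\{1,2,3,\dots\}$. $G_{1,\ell}$ and $G_{2,\ell}$ are the $(\ell+1)\times(\ell+1)$-matrices depending on $(\chi,a,s)\in\mathbb C^3$ with the following entries: for $1\le j\le \ell$: $(G_{1,\ell})_{j,j}=\frac s2$, $(G_{1,\ell})_{j,j+1}=\chi a-j$, $(G_{2,\ell})_{j,\ell+1-j}=\frac a2$, $(G_{2,\ell})_{j,\ell+2-j}=\chi s$; $(G_{1,\ell})_{\ell+1,\ell+1}=\frac12$, $(G_{2,\ell})_{\ell+1,1}=\chi$; all other entries are zero. The surfaces $S_{\ell,\pm}$ are called the determinantal surfaces. *)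

theory Defs
  imports Jordan_Normal_Form.Determinant
    "HOL-Computational_Algebra.Computational_Algebra"
    "HOL-Library.Extended_Nat"
begin

text \<open>
  The polynomial ring in the three variables (\<chi>, a, s) over the complex numbers is
  represented as the iterated ring C[\<chi>][a][s]: the outermost variable is s, the
  innermost one is \<chi>.
\<close>

type_synonym poly3 = "complex poly poly poly"

definition Const3 :: "complex \<Rightarrow> poly3" where
  "Const3 c = [:[:[:c:]:]:]"

definition X_chi :: poly3 where "X_chi = [:[:[:0, 1:]:]:]"
definition X_a :: poly3 where "X_a = [:[:0, 1:]:]"
definition X_s :: poly3 where "X_s = [:0, 1:]"

text \<open>
  \<^term>\<open>eval3 \<phi> x y z p\<close> is p(x, y, z), that is, the result of substituting x, y, z for
  \<chi>, a, s and applying \<phi> to the coefficients. For \<phi> the identity this is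
  the value of p at a point; for \<phi> the embedding of constants it is polynomial substitution.
\<close>

definition eval3 :: "(complex \<Rightarrow> 'r::comm_ring_1) \<Rightarrow> 'r \<Rightarrow> 'r \<Rightarrow> 'r \<Rightarrow> poly3 \<Rightarrow> 'r" where
  "eval3 \<phi> x y z p =
     poly (map_poly (\<lambda>q. poly (map_poly (\<lambda>r. poly (map_poly \<phi> r) x) q) y) p) z"

definition value3 :: "poly3 \<Rightarrow> complex \<times> complex \<times> complex \<Rightarrow> complex" where
  "value3 p = (\<lambda>(x, y, z). eval3 (\<lambda>c. c) x y z p)"

definition subst3 :: "poly3 \<Rightarrow> poly3 \<Rightarrow> poly3 \<Rightarrow> poly3 \<Rightarrow> poly3" where
  "subst3 p x y z = eval3 Const3 x y z p"

text \<open>The entry functions use row and column indices 1, ..., l + 1, whereas matrices are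
  indexed from 0.\<close>

definition G1_entry :: "nat \<Rightarrow> nat \<Rightarrow> nat \<Rightarrow> poly3" where
  "G1_entry l j k =
     (if 1 \<le> j \<and> j \<le> l \<and> k = j then Const3 (1/2) * X_s
      else if 1 \<le> j \<and> j \<le> l \<and> k = j + 1 then X_chi * X_a - of_nat j
      else if j = l + 1 \<and> k = l + 1 then Const3 (1/2)
      else 0)"

definition G2_entry :: "nat \<Rightarrow> nat \<Rightarrow> nat \<Rightarrow> poly3" where
  "G2_entry l j k =
     (if 1 \<le> j \<and> j \<le> l \<and> k = l + 1 - j then Const3 (1/2) * X_a
      else if 1 \<le> j \<and> j \<le> l \<and> k = l + 2 - j then X_chi * X_s
      else if j = l + 1 \<and> k = 1 then X_chi
      else 0)"

definition G1 :: "nat \<Rightarrow> poly3 mat" where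
  "G1 l = mat (l + 1) (l + 1) (\<lambda>(i, k). G1_entry l (i + 1) (k + 1))"

definition G2 :: "nat \<Rightarrow> poly3 mat" where
  "G2 l = mat (l + 1) (l + 1) (\<lambda>(i, k). G2_entry l (i + 1) (k + 1))"

definition P_plus :: "nat \<Rightarrow> poly3" where "P_plus l = det (G1 l + G2 l)"
definition P_minus :: "nat \<Rightarrow> poly3" where "P_minus l = det (G1 l - G2 l)"

definition zero_locus :: "poly3 set \<Rightarrow> (complex \<times> complex \<times> complex) set" where
  "zero_locus A = {v. \<forall>p\<in>A. value3 p v = 0}"

definition algebraic_set :: "(complex \<times> complex \<times> complex) set \<Rightarrow> bool" where
  "algebraic_set Z \<longleftrightarrow> (\<exists>A. Z = zero_locus A)"

definition irreducible_algebraic_set :: "(complex \<times> complex \<times> complex) set \<Rightarrow> bool" where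
  "irreducible_algebraic_set Z \<longleftrightarrow>
     algebraic_set Z \<and> Z \<noteq> {} \<and>
     (\<forall>V W. algebraic_set V \<longrightarrow> algebraic_set W \<longrightarrow> Z = V \<union> W \<longrightarrow> Z = V \<or> Z = W)"

text \<open>Krull dimension: the supremum of the lengths n of strictly increasing chains
  \<open>C 0 \<subset> ... \<subset> C n\<close> of irreducible algebraic subsets (the empty set gets
  dimension 0 here, but it is not irreducible).\<close>

definition algebraic_dim :: "(complex \<times> complex \<times> complex) set \<Rightarrow> enat" where
  "algebraic_dim Z =
     Sup {enat n | n. \<exists>C :: nat \<Rightarrow> (complex \<times> complex \<times> complex) set.
            (\<forall>i\<le>n. irreducible_algebraic_set (C i) \<and> C i \<subseteq> Z) \<and>
            (\<forall>i<n. C i \<subset> C (Suc i))}"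

definition irreducible_affine_surface :: "(complex \<times> complex \<times> complex) set \<Rightarrow> bool" where
  "irreducible_affine_surface Z \<longleftrightarrow> irreducible_algebraic_set Z \<and> algebraic_dim Z = 2"

definition S_plus :: "nat \<Rightarrow> (complex \<times> complex \<times> complex) set" where
  "S_plus l = zero_locus {P_plus l}"

definition S_minus :: "nat \<Rightarrow> (complex \<times> complex \<times> complex) set" where
  "S_minus l = zero_locus {P_minus l}"

definition sign_involution ::
  "complex \<times> complex \<times> complex \<Rightarrow> complex \<times> complex \<times> complex" where
  "sign_involution = (\<lambda>(x, y, z). (- x, - y, z))"

end

theory Submission
  imports Defs "Jordan_Normal_Form.Char_Poly" "HOL-Computational_Algebra.Field_as_Ring"
begin

text \<open>
  Write \<open>n = l + 1\<close>, let \<open>J\<close> be the matrix reversing the order of the coordinates and put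
  \<open>\<delta> = 1/4 - \<chi>\<^sup>2\<close>. Multiplying \<open>G\<^sub>1 + G\<^sub>2\<close> from the right by \<open>1/2 - \<chi> J\<close> clears the last row up to
  its diagonal entry \<open>\<delta>\<close>; reversing the columns of the remaining block gives \<open>\<chi>\<close> times
  \<open>b + N(t, \<sigma>)\<close>, where \<open>t = 1/\<chi>\<close>, \<open>\<sigma> = s \<delta>/\<chi>\<close>, \<open>b = a \<delta>/\<chi>\<close> and \<open>N\<close> has entries \<open>j\<close> at
  \<open>(j, j)\<close>, \<open>\<sigma>\<close> at \<open>(j, n - j)\<close> and \<open>- t j/2\<close> at \<open>(j, l - j)\<close>.

  The polynomial \<open>Q = det (b + N)\<close> is irreducible: on the line \<open>t = \<sigma> = 0\<close> it has the simple roots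
  \<open>b = -1, ..., -l\<close>, so each of these points lies on exactly one of two complementary factors. For
  \<open>t = 0\<close> it vanishes on conics joining the points \<open>-j\<close> and \<open>-(n - j)\<close>, for \<open>\<sigma> = 0\<close> on conics joining
  \<open>-j\<close> and \<open>-(l - j)\<close>. Together these conics connect all the points, so one factor has no root on
  the line and is constant, because \<open>Q\<close> is monic in \<open>b\<close>. Transported back, one factor of the
  determinant depends on \<open>\<chi>\<close> only; the values for \<open>a = s = 0\<close> and for \<open>\<chi> = a = 0\<close> show
  that it is constant.

  The zero locus of an irreducible polynomial is irreducible because a polynomial vanishing on it
  is a multiple. Its dimension is at least 2 since it contains a rational curve, and at most 2
  because four polynomials in three variables are algebraically dependent: choosing one polynomial
  for each step of a chain of irreducible sets that vanishes on the smaller but not on the larger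
  set, and dividing an algebraic relation successively by these polynomials, one sees that a
  chain of length 4 in the affine space cannot exist.
\<close>

section \<open>Evaluation and substitution\<close>

lemma comm_ring_hom_poly_map_poly:
  fixes h :: "'a::comm_ring_1 \<Rightarrow> 'b::comm_ring_1"
  assumes "comm_ring_hom h"
  shows "comm_ring_hom (\<lambda>p. poly (map_poly h p) x)"
proof -
  interpret comm_ring_hom h by fact
  interpret m: map_poly_comm_ring_hom h ..
  show ?thesis by unfold_locales (simp_all add: m.hom_add m.hom_mult)
qed

lemma comm_ring_hom_eval3:
  assumes "comm_ring_hom \<phi>"
  shows "comm_ring_hom (eval3 \<phi> x y z)"
proof -
  have "eval3 \<phi> x y z = (\<lambda>p. poly (map_poly
      (\<lambda>q. poly (map_poly (\<lambda>r. poly (map_poly \<phi> r) x) q) y) p) z)"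
    by (auto simp: eval3_def)
  then show ?thesis
    by (simp only:) (intro comm_ring_hom_poly_map_poly assms)
qed

lemma comm_ring_hom_Const3: "comm_ring_hom Const3"
  by unfold_locales (auto simp: Const3_def one_pCons)

lemma comm_ring_hom_ident: "comm_ring_hom (\<lambda>c::complex. c)"
  by unfold_locales auto

lemma comm_ring_hom_value3: "comm_ring_hom (\<lambda>p. value3 p v)"
proof -
  obtain x y z where "v = (x, y, z)" by (cases v)
  then have "(\<lambda>p. value3 p v) = eval3 (\<lambda>c. c) x y z"
    by (simp add: value3_def fun_eq_iff)
  then show ?thesis
    using comm_ring_hom_eval3[OF comm_ring_hom_ident] by simp
qed

interpretation value3: comm_ring_hom "\<lambda>p. value3 p v" for v
  by (rule comm_ring_hom_value3)

lemma eval3_gens: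
  assumes "comm_ring_hom \<phi>"
  shows "eval3 \<phi> x y z (Const3 c) = \<phi> c"
    and "eval3 \<phi> x y z X_chi = x"
    and "eval3 \<phi> x y z X_a = y"
    and "eval3 \<phi> x y z X_s = z"
proof -
  interpret comm_ring_hom \<phi> by fact
  define h1 where "h1 = (\<lambda>r. poly (map_poly \<phi> r) x)"
  define h2 where "h2 = (\<lambda>q. poly (map_poly h1 q) y)"
  interpret h1: comm_ring_hom h1
    unfolding h1_def by (intro comm_ring_hom_poly_map_poly assms)
  interpret h2: comm_ring_hom h2
    unfolding h2_def by (intro comm_ring_hom_poly_map_poly h1.comm_ring_hom_axioms)
  have h1: "h1 [:c, d:] = \<phi> c + x * \<phi> d" "h1 [:c:] = \<phi> c" for c d
    by (simp_all add: h1_def map_poly_pCons_hom)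
  have h2: "h2 [:c, d:] = h1 c + y * h1 d" "h2 [:c:] = h1 c" for c d
    by (simp_all add: h2_def h1.map_poly_pCons_hom)
  have e: "eval3 \<phi> x y z p = poly (map_poly h2 p) z" for p
    by (simp add: eval3_def h2_def h1_def)
  show "eval3 \<phi> x y z (Const3 c) = \<phi> c" "eval3 \<phi> x y z X_chi = x"
    "eval3 \<phi> x y z X_a = y" "eval3 \<phi> x y z X_s = z"
    by (simp_all add: e Const3_def X_chi_def X_a_def X_s_def h2.map_poly_pCons_hom h1 h2)
qed

lemma value3_gens [simp]:
  "value3 (Const3 c) (x, y, z) = c"
  "value3 X_chi (x, y, z) = x"
  "value3 X_a (x, y, z) = y"
  "value3 X_s (x, y, z) = z"
  by (simp_all add: value3_def eval3_gens[OF comm_ring_hom_ident])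

text \<open>In each layer of coefficients \<open>pCons\<close> is a constant from the layer below
  plus the variable times the tail. Identities between ring homomorphisms then need checking on
  generators only.\<close>

lemma poly3_induct [case_names Const chi a s add mult]:
  fixes p :: poly3
  assumes C: "\<And>c. P (Const3 c)" and P1: "P X_chi" and P2: "P X_a" and P3: "P X_s"
    and A: "\<And>p q. P p \<Longrightarrow> P q \<Longrightarrow> P (p + q)"
    and M: "\<And>p q. P p \<Longrightarrow> P q \<Longrightarrow> P (p * q)"
  shows "P p"
proof -
  have 1: "P [:[:r:]:]" for r :: "complex poly"
  proof (induction r)
    case 0
    then show ?case using C[of 0] by (simp add: Const3_def)
  next
    case (pCons a r)
    have "[:[:pCons a r:]:] = Const3 a + X_chi * [:[:r:]:]"
      by (simp add: Const3_def X_chi_def)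
    then show ?case using A[OF C M[OF P1 pCons.IH]] by simp
  qed
  have 2: "P [:q:]" for q :: "complex poly poly"
  proof (induction q)
    case 0
    then show ?case using C[of 0] by (simp add: Const3_def)
  next
    case (pCons a r)
    have "[:pCons a r:] = [:[:a:]:] + X_a * [:r:]"
      by (simp add: X_a_def)
    then show ?case using A[OF 1 M[OF P2 pCons.IH]] by simp
  qed
  show ?thesis
  proof (induction p)
    case 0
    then show ?case using C[of 0] by (simp add: Const3_def)
  next
    case (pCons a r)
    have "pCons a r = [:a:] + X_s * r"
      by (simp add: X_s_def)
    then show ?case using A[OF 2 M[OF P3 pCons.IH]] by simp
  qed
qed

text \<open>Whereas \<open>eval3\<close> maps coefficients from the inside out, this form plugs in
  constants from the outermost variable inwards, so that \<open>poly\<close> computes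
  directly.\<close>

lemma value3_eq_poly:
  "value3 p (x, y, z) = poly (poly (poly p [:[:z:]:]) [:y:]) x"
  by (induction p rule: poly3_induct)
    (simp_all add: value3.hom_add value3.hom_mult, simp_all add: Const3_def X_chi_def X_a_def X_s_def)

lemma poly_eq_0_on_infinite:
  fixes p :: "'a::idom poly"
  assumes "infinite A" "\<And>x. x \<in> A \<Longrightarrow> poly p x = 0"
  shows "p = 0"
  using assms poly_roots_finite[of p] by (metis (mono_tags, lifting) finite_subset mem_Collect_eq subsetI)

text \<open>A nonzero polynomial over a domain has finitely many roots, and the constants are
  infinitely many in each layer. Polynomial identities can hence be proved pointwise.\<close>

lemma value3_eq_0_imp_eq_0:
  assumes "\<And>x y z. value3 p (x, y, z) = 0"
  shows "p = 0"
proof (rule poly_eq_0_on_infinite)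
  show "infinite (range (\<lambda>z::complex. [:[:z:]:]))"
    by (subst finite_image_iff) (auto simp: inj_on_def infinite_UNIV_char_0)
  have i: "infinite (range (\<lambda>z::complex. [:z:]))"
    by (subst finite_image_iff) (auto simp: inj_on_def infinite_UNIV_char_0)
  fix w :: "complex poly poly" assume "w \<in> range (\<lambda>z. [:[:z:]:])"
  then obtain z where w: "w = [:[:z:]:]" by auto
  show "poly p w = 0"
  proof (rule poly_eq_0_on_infinite[OF i])
    fix u :: "complex poly" assume "u \<in> range (\<lambda>z. [:z:])"
    then obtain y where u: "u = [:y:]" by auto
    have "poly (poly (poly p w) u) x = 0" for x
      using assms[of x y z] by (simp add: u w value3_eq_poly)
    then show "poly (poly p w) u = 0"
      using poly_all_0_iff_0 by blast
  qed
qed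

lemma value3_eq_iff: "value3 p = value3 q \<longleftrightarrow> p = q"
proof
  assume "value3 p = value3 q"
  then have "p - q = 0"
    by (intro value3_eq_0_imp_eq_0) (simp add: value3.hom_minus)
  then show "p = q" by simp
qed simp

lemma subst3_hom: "comm_ring_hom (\<lambda>p. subst3 p x y z)"
  unfolding subst3_def using comm_ring_hom_eval3[OF comm_ring_hom_Const3] by simp

interpretation subst3: comm_ring_hom "\<lambda>p. subst3 p x y z" for x y z
  by (rule subst3_hom)

lemma subst3_gens [simp]:
  "subst3 (Const3 c) x y z = Const3 c"
  "subst3 X_chi x y z = x"
  "subst3 X_a x y z = y"
  "subst3 X_s x y z = z"
  by (simp_all add: subst3_def eval3_gens[OF comm_ring_hom_Const3])

lemma value3_subst3:
  "value3 (subst3 p x y z) v = value3 p (value3 x v, value3 y v, value3 z v)"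
  by (induction p rule: poly3_induct; cases v)
    (simp_all add: value3.hom_add value3.hom_mult subst3.hom_add subst3.hom_mult)

section \<open>Hypersurfaces and irreducible algebraic sets\<close>

text \<open>The Nullstellensatz for a hypersurface. If \<open>p\<close> did not divide
  \<open>f\<close>, the ideal generated by both would contain a nonzero \<open>h\<close> free of the
  outermost variable. Over a point where neither \<open>h\<close> nor the leading coefficient of
  \<open>p\<close> vanishes, \<open>p\<close> has a root by the fundamental theorem of algebra;
  there \<open>f\<close> and hence \<open>h\<close> would vanish.\<close>

lemma algebraic_hypersurface_dvd:
  fixes p f :: poly3
  assumes irr: "irreducible p" and deg: "degree p > 0"
    and van: "\<And>v. value3 p v = 0 \<Longrightarrow> value3 f v = 0"
  shows "p dvd f"
proof (rule ccontr)
  assume ndvd: "\<not> p dvd f"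
  have prime: "prime_elem p"
    using irr by (rule irreducible_imp_prime_elem)
  define I where "I = {A * p + B * f | A B. True}"
  have I_lin: "u * x + w * y \<in> I" if "x \<in> I" "y \<in> I" for u w x y
  proof -
    from that obtain A B A' B' where "x = A * p + B * f" "y = A' * p + B' * f"
      by (auto simp: I_def)
    then have "u * x + w * y = (u * A + w * A') * p + (u * B + w * B') * f"
      by (simp add: algebra_simps)
    then show ?thesis unfolding I_def by blast
  qed
  have pI: "p \<in> I" unfolding I_def by (auto intro: exI[of _ 1] exI[of _ 0])
  have fI: "f \<in> I" unfolding I_def by (auto intro: exI[of _ 1] exI[of _ 0])
  have "\<exists>h. h \<in> I \<and> h \<noteq> 0"
    using pI irr by (metis not_irreducible_zero)
  then obtain h where h: "h \<in> I" "h \<noteq> 0"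
    and min: "\<And>g. g \<in> I \<Longrightarrow> g \<noteq> 0 \<Longrightarrow> degree h \<le> degree g"
    using ex_has_least_nat[of "\<lambda>h. h \<in> I \<and> h \<noteq> 0" _ degree] by metis
  \<comment> \<open>The coefficients do not form a field, so \<open>g\<close> is pseudo-divided by
    \<open>h\<close>; minimality of the degree of \<open>h\<close> kills the remainder.\<close>
  have div: "\<exists>c q. c \<noteq> 0 \<and> smult c g = h * q" if g: "g \<in> I" for g
  proof -
    obtain q r where qr: "pseudo_divmod g h = (q, r)" by fastforce
    define c where "c = coeff h (degree h) ^ (Suc (degree g) - degree h)"
    have c: "c \<noteq> 0" using h by (simp add: c_def)
    have eq: "smult c g = h * q + r"
      using pseudo_divmod(1)[OF h(2) qr] by (simp add: c_def)
    have "r = [:c:] * g + (- q) * h"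
      using eq by (simp add: algebra_simps)
    then have "r \<in> I" using I_lin[OF g h(1)] by metis
    moreover have "r = 0 \<or> degree r < degree h"
      using pseudo_divmod(2)[OF h(2) qr] .
    ultimately have "r = 0" using min by force
    then show ?thesis using c eq by auto
  qed
  have const: "\<not> p dvd [:c:]" if "c \<noteq> 0" for c
    using that deg dvd_imp_degree_le[of p "[:c:]"] by auto
  \<comment> \<open>\<open>p\<close> does not divide \<open>h\<close>, as it would then divide
    \<open>f\<close> up to the constant \<open>c'\<close>. So \<open>p\<close> divides
    \<open>q\<close>, and cancelling it leaves \<open>h\<close> as a divisor of
    \<open>[:c:]\<close>.\<close>
  have deg_h: "degree h = 0"
  proof -
    obtain c q where c: "c \<noteq> 0" "[:c:] * p = h * q" using div[OF pI] by auto
    obtain c' q' where c': "c' \<noteq> 0" "[:c':] * f = h * q'" using div[OF fI] by auto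
    have "\<not> p dvd h"
    proof
      assume "p dvd h"
      then have "p dvd [:c':] * f" using c'(2) by simp
      then show False using prime const[OF c'(1)] ndvd prime_elem_dvd_mult_iff by blast
    qed
    moreover have "p dvd h * q" using c(2) by (metis dvd_triv_right)
    ultimately have "p dvd q" using prime prime_elem_dvd_mult_iff by blast
    then obtain k where "q = p * k" ..
    then have "p * [:c:] = p * (h * k)" using c(2) by (simp add: mult_ac)
    then have "[:c:] = h * k" using irr by (metis mult_cancel_left not_irreducible_zero)
    then have "h dvd [:c:]" by simp
    then show ?thesis using c(1) dvd_imp_degree_le[of h "[:c:]"] by auto
  qed
  then obtain r where r: "h = [:r:]" by (metis degree_eq_zeroE)
  \<comment> \<open>A point off the zeros of this product serves both \<open>r\<close> and the
    leading coefficient of \<open>p\<close>.\<close>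
  define w where "w = r * lead_coeff p"
  have "w \<noteq> 0" using h r irr by (auto simp: w_def)
  then have "[:w:] \<noteq> 0" by simp
  then obtain x y z where xyz: "value3 [:w:] (x, y, z) \<noteq> 0"
    using value3_eq_0_imp_eq_0 by blast
  interpret ev: comm_ring_hom "\<lambda>q. poly (poly q [:y:]) x"
    by unfold_locales simp_all
  define P where "P = map_poly (\<lambda>q. poly (poly q [:y:]) x) p"
  have lc: "poly (poly (lead_coeff p) [:y:]) x \<noteq> 0" and r0: "poly (poly r [:y:]) x \<noteq> 0"
    using xyz by (auto simp: value3_eq_poly w_def)
  have "coeff P (degree p) \<noteq> 0" using lc by (simp add: P_def)
  then have "degree P > 0" using deg le_degree[of P "degree p"] by simp
  then have "\<not> constant (poly P)" by (simp add: constant_degree)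
  then obtain z' where z': "poly P z' = 0"
    using fundamental_theorem_of_algebra by blast
  have "value3 p (x, y, z') = poly P (poly (poly [:[:z':]:] [:y:]) x)"
    unfolding value3_eq_poly P_def ev.poly_map_poly ..
  then have p0: "value3 p (x, y, z') = 0" using z' by simp
  obtain A B where "h = A * p + B * f" using h(1) by (auto simp: I_def)
  then have "value3 h (x, y, z') = 0"
    using p0 van[OF p0] by (simp add: value3.hom_add value3.hom_mult)
  then show False using r0 by (simp add: r value3_eq_poly)
qed

text \<open>Adding \<open>f\<close> or \<open>g\<close> to the equations of \<open>Z\<close> gives
  two algebraic sets covering it, one of which must be all of \<open>Z\<close>: the vanishing ideal
  is prime.\<close>

lemma irreducible_algebraic_setD:
  assumes Z: "irreducible_algebraic_set Z"
    and fg: "\<And>v. v \<in> Z \<Longrightarrow> value3 f v * value3 g v = 0"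
  shows "(\<forall>v\<in>Z. value3 f v = 0) \<or> (\<forall>v\<in>Z. value3 g v = 0)"
proof -
  obtain A where A: "Z = zero_locus A"
    using Z by (auto simp: irreducible_algebraic_set_def algebraic_set_def)
  have "Z = zero_locus (insert f A) \<union> zero_locus (insert g A)"
    using fg by (auto simp: A zero_locus_def)
  then have "Z = zero_locus (insert f A) \<or> Z = zero_locus (insert g A)"
    using Z by (auto simp: irreducible_algebraic_set_def algebraic_set_def)
  then show ?thesis by (auto simp: zero_locus_def)
qed

text \<open>If \<open>V\<close> and \<open>W\<close> were both proper, an equation of each that
  fails somewhere on \<open>Z\<close> would give two functions whose product vanishes on all of
  \<open>Z\<close>.\<close>

lemma irreducible_algebraic_setI:
  assumes alg: "algebraic_set Z" and ne: "Z \<noteq> {}"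
    and dom: "\<And>f g. (\<And>v. v \<in> Z \<Longrightarrow> value3 f v * value3 g v = 0) \<Longrightarrow>
      (\<forall>v\<in>Z. value3 f v = 0) \<or> (\<forall>v\<in>Z. value3 g v = 0)"
  shows "irreducible_algebraic_set Z"
  unfolding irreducible_algebraic_set_def
proof (intro conjI allI impI alg ne)
  fix V W assume V: "algebraic_set V" and W: "algebraic_set W" and Z: "Z = V \<union> W"
  obtain A B where A: "V = zero_locus A" and B: "W = zero_locus B"
    using V W by (auto simp: algebraic_set_def)
  show "Z = V \<or> Z = W"
  proof (rule ccontr)
    assume "\<not> (Z = V \<or> Z = W)"
    then obtain v w where vw: "v \<in> Z" "v \<notin> V" "w \<in> Z" "w \<notin> W" using Z by blast
    then obtain f g where f: "f \<in> A" "value3 f v \<noteq> 0" and g: "g \<in> B" "value3 g w \<noteq> 0"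
      by (auto simp: A B zero_locus_def)
    have "value3 f u * value3 g u = 0" if "u \<in> Z" for u
      using that f(1) g(1) by (auto simp: Z A B zero_locus_def)
    then show False using dom vw f g by blast
  qed
qed

lemma algebraic_subset_separate:
  assumes "algebraic_set C" "C \<subset> C'"
  obtains f v where "\<And>u. u \<in> C \<Longrightarrow> value3 f u = 0" "v \<in> C'" "value3 f v \<noteq> 0"
proof -
  obtain A where A: "C = zero_locus A" using assms(1) by (auto simp: algebraic_set_def)
  obtain v where v: "v \<in> C'" "v \<notin> C" using assms(2) by blast
  then obtain f where "f \<in> A" "value3 f v \<noteq> 0" by (auto simp: A zero_locus_def)
  then show thesis using v that[of f v] by (auto simp: A zero_locus_def)
qed

lemma irreducible_algebraic_set_UNIV: "irreducible_algebraic_set UNIV"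
proof (rule irreducible_algebraic_setI)
  show "algebraic_set UNIV"
    unfolding algebraic_set_def by (rule exI[of _ "{}"]) (simp add: zero_locus_def)
  fix f g assume "\<And>v. v \<in> UNIV \<Longrightarrow> value3 f v * value3 g v = 0"
  then have "f * g = 0"
    by (intro value3_eq_0_imp_eq_0) (simp add: value3.hom_mult)
  then show "(\<forall>v\<in>UNIV. value3 f v = 0) \<or> (\<forall>v\<in>UNIV. value3 g v = 0)"
    by auto
qed simp

lemma irreducible_algebraic_set_singleton: "irreducible_algebraic_set {v}"
proof (rule irreducible_algebraic_setI)
  obtain x y z where v: "v = (x, y, z)" by (cases v)
  have "{v} = zero_locus {X_chi - Const3 x, X_a - Const3 y, X_s - Const3 z}"
    by (auto simp: v zero_locus_def value3.hom_minus)
  then show "algebraic_set {v}" by (auto simp: algebraic_set_def)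
qed auto

text \<open>Vanishing on the locus means being a multiple of \<open>p\<close>, so this is primality
  of \<open>p\<close>; an empty locus would make \<open>p\<close> a unit.\<close>

lemma irreducible_hypersurface:
  assumes irr: "irreducible p" and deg: "degree p > 0"
  shows "irreducible_algebraic_set (zero_locus {p})"
proof (rule irreducible_algebraic_setI)
  show "algebraic_set (zero_locus {p})" by (auto simp: algebraic_set_def)
  show "zero_locus {p} \<noteq> {}"
  proof
    assume "zero_locus {p} = {}"
    then have "p dvd 1"
      by (intro algebraic_hypersurface_dvd[OF irr deg]) (auto simp: zero_locus_def)
    then show False using irr by (simp add: irreducible_def)
  qed
  fix f g assume "\<And>v. v \<in> zero_locus {p} \<Longrightarrow> value3 f v * value3 g v = 0"
  then have "p dvd f * g"
    by (intro algebraic_hypersurface_dvd[OF irr deg]) (auto simp: zero_locus_def value3.hom_mult)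
  then have "p dvd f \<or> p dvd g"
    using irreducible_imp_prime_elem[OF irr] prime_elem_dvd_mult_iff by blast
  then show "(\<forall>v\<in>zero_locus {p}. value3 f v = 0) \<or> (\<forall>v\<in>zero_locus {p}. value3 g v = 0)"
    by (auto simp: zero_locus_def value3.hom_mult elim!: dvdE)
qed

section \<open>Dimension\<close>

text \<open>The vectors form a family because different exponents may give equal products; a
  repetition is itself a relation with coefficients 1 and -1.\<close>

lemma (in vector_space) linear_relation_if_card_gt:
  assumes I: "finite I" and T: "finite T" and card: "card T < card I"
    and span: "\<And>i. i \<in> I \<Longrightarrow> F i \<in> span T"
  shows "\<exists>c. (\<exists>i\<in>I. c i \<noteq> 0) \<and> (\<Sum>i\<in>I. c i *s F i) = 0"
proof (cases "inj_on F I")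
  case True
  have "dependent (F ` I)"
  proof (rule ccontr)
    assume "\<not> dependent (F ` I)"
    then have "card (F ` I) \<le> card T"
      using independent_span_bound[OF T] span by blast
    then show False using card card_image[OF True] by simp
  qed
  then have "\<exists>u. (\<exists>v\<in>F ` I. u v \<noteq> 0) \<and> (\<Sum>v\<in>F ` I. u v *s v) = 0"
    by (subst (asm) dependent_finite) (use I in auto)
  then obtain u where u: "\<exists>v\<in>F ` I. u v \<noteq> 0" "(\<Sum>v\<in>F ` I. u v *s v) = 0"
    by (elim exE conjE)
  then show ?thesis
    by (intro exI[of _ "\<lambda>i. u (F i)"]) (simp_all add: sum.reindex[OF True])
next
  case False
  then obtain i j where ij: "i \<in> I" "j \<in> I" "F i = F j" "i \<noteq> j"
    by (auto simp: inj_on_def)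
  define c where "c k = (if k = i then 1 else if k = j then - 1 else (0::'a))" for k
  have "(\<Sum>k\<in>I. c k *s F k) = (\<Sum>k\<in>{i, j}. c k *s F k)"
    using ij I by (intro sum.mono_neutral_right) (auto simp: c_def)
  also have "\<dots> = 0" using ij by (simp add: c_def)
  finally show ?thesis using ij by (intro exI[of _ c]) (auto simp: c_def)
qed

interpretation poly3: vector_space "\<lambda>c (p::poly3). Const3 c * p"
proof -
  interpret c: comm_ring_hom Const3 by (rule comm_ring_hom_Const3)
  show "vector_space (\<lambda>c (p::poly3). Const3 c * p)"
    by unfold_locales (simp_all add: c.hom_add c.hom_mult algebra_simps)
qed

text \<open>Each exponent is bounded separately: bounds add under multiplication, and the count is
  at most cubic in the bound.\<close>

definition monomials3 :: "nat \<Rightarrow> poly3 set" where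
  "monomials3 d = (\<lambda>(i, j, k). X_chi ^ i * X_a ^ j * X_s ^ k) ` ({..d} \<times> {..d} \<times> {..d})"

lemma finite_monomials3: "finite (monomials3 d)"
  by (simp add: monomials3_def)

lemma card_monomials3: "card (monomials3 d) \<le> Suc d ^ 3"
proof -
  have "card (monomials3 d) \<le> card ({..d} \<times> {..d} \<times> {..d})"
    unfolding monomials3_def by (rule card_image_le) simp
  also have "\<dots> = Suc d ^ 3" by (simp add: card_cartesian_product power3_eq_cube)
  finally show ?thesis .
qed

lemma monomials3_mono: "d \<le> e \<Longrightarrow> monomials3 d \<subseteq> monomials3 e"
  unfolding monomials3_def by (intro image_mono) auto

lemma monomial3_mult:
  assumes "p \<in> monomials3 d" "q \<in> monomials3 e"
  shows "p * q \<in> monomials3 (d + e)"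
proof -
  from assms obtain i j k i' j' k' where
    "p = X_chi ^ i * X_a ^ j * X_s ^ k" "q = X_chi ^ i' * X_a ^ j' * X_s ^ k'"
    "i \<le> d" "j \<le> d" "k \<le> d" "i' \<le> e" "j' \<le> e" "k' \<le> e"
    by (auto simp: monomials3_def)
  then show ?thesis unfolding monomials3_def
    by (intro image_eqI[of _ _ "(i + i', j + j', k + k')"]) (auto simp: power_add algebra_simps)
qed

lemma span_monomials3_mult:
  assumes p: "p \<in> poly3.span (monomials3 d)" and q: "q \<in> poly3.span (monomials3 e)"
  shows "p * q \<in> poly3.span (monomials3 (d + e))"
proof -
  have 1: "m * q \<in> poly3.span (monomials3 (d + e))" if m: "m \<in> monomials3 d" for m
    using q
  proof (induction rule: poly3.span_induct_alt)
    case base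
    then show ?case by (simp add: poly3.span_zero)
  next
    case (step c x y)
    have "m * (Const3 c * x + y) = Const3 c * (m * x) + m * y"
      by (simp add: algebra_simps)
    then show ?case
      using step poly3.span_base[OF monomial3_mult[OF m step(1)]]
      by (simp add: poly3.span_add poly3.span_scale)
  qed
  show ?thesis using p
  proof (induction rule: poly3.span_induct_alt)
    case base
    then show ?case by (simp add: poly3.span_zero)
  next
    case (step c x y)
    have "(Const3 c * x + y) * q = Const3 c * (x * q) + y * q"
      by (simp add: algebra_simps)
    then show ?case
      using step 1[OF step(1)] by (simp add: poly3.span_add poly3.span_scale)
  qed
qed

lemma span_monomials3_mono:
  "d \<le> e \<Longrightarrow> p \<in> poly3.span (monomials3 d) \<Longrightarrow> p \<in> poly3.span (monomials3 e)"
  using poly3.span_mono[OF monomials3_mono] by blast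

lemma span_monomials3_power:
  assumes "p \<in> poly3.span (monomials3 d)"
  shows "p ^ n \<in> poly3.span (monomials3 (n * d))"
proof (induction n)
  case 0
  have "1 \<in> monomials3 0" by (simp add: monomials3_def)
  then show ?case by (simp add: poly3.span_base)
next
  case (Suc n)
  then show ?case using span_monomials3_mult[OF assms Suc] by simp
qed

lemma in_span_monomials3: "\<exists>d. p \<in> poly3.span (monomials3 d)"
proof (induction p rule: poly3_induct)
  case (Const c)
  have "1 \<in> monomials3 0" by (simp add: monomials3_def)
  then have "Const3 c * 1 \<in> poly3.span (monomials3 0)"
    by (intro poly3.span_scale poly3.span_base)
  then show ?case by auto
next
  case chi
  have "X_chi \<in> monomials3 1" unfolding monomials3_def
    by (intro image_eqI[of _ _ "(1, 0, 0)"]) auto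
  then show ?case by (blast intro: poly3.span_base)
next
  case a
  have "X_a \<in> monomials3 1" unfolding monomials3_def
    by (intro image_eqI[of _ _ "(0, 1, 0)"]) auto
  then show ?case by (blast intro: poly3.span_base)
next
  case s
  have "X_s \<in> monomials3 1" unfolding monomials3_def
    by (intro image_eqI[of _ _ "(0, 0, 1)"]) auto
  then show ?case by (blast intro: poly3.span_base)
next
  case (add p q)
  then obtain d e where "p \<in> poly3.span (monomials3 d)" "q \<in> poly3.span (monomials3 e)" by blast
  then have "p + q \<in> poly3.span (monomials3 (max d e))"
    by (intro poly3.span_add) (auto elim: span_monomials3_mono[rotated])
  then show ?case ..
next
  case (mult p q)
  then show ?case using span_monomials3_mult by blast
qed

text \<open>The \<open>N\<^sup>4\<close> monomials in \<open>f\<^sub>1, \<dots>, f\<^sub>4\<close> with exponents below \<open>N\<close> lie in a space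
  of dimension \<open>O(N\<^sup>3)\<close>.\<close>

lemma four_polynomials_algebraically_dependent:
  fixes f1 f2 f3 f4 :: poly3
  obtains N and c :: "nat \<Rightarrow> nat \<Rightarrow> nat \<Rightarrow> nat \<Rightarrow> complex"
  where "\<exists>i<N. \<exists>j<N. \<exists>k<N. \<exists>m<N. c i j k m \<noteq> 0"
    and "(\<Sum>i<N. f1 ^ i * (\<Sum>j<N. f2 ^ j * (\<Sum>k<N. f3 ^ k *
           (\<Sum>m<N. f4 ^ m * Const3 (c i j k m))))) = 0"
proof -
  obtain d1 d2 d3 d4 where d:
    "f1 \<in> poly3.span (monomials3 d1)" "f2 \<in> poly3.span (monomials3 d2)"
    "f3 \<in> poly3.span (monomials3 d3)" "f4 \<in> poly3.span (monomials3 d4)"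
    using in_span_monomials3[of f1] in_span_monomials3[of f2] in_span_monomials3[of f3]
      in_span_monomials3[of f4] by blast
  define D where "D = d1 + d2 + d3 + d4"
  \<comment> \<open>Since \<open>N\<close> exceeds \<open>Suc D ^ 3\<close>, the bound
    \<open>(N * Suc D) ^ 3\<close> on the dimension is below \<open>N ^ 4\<close>, the number of
    exponent tuples.\<close>
  define N where "N = Suc D ^ 3 + 1"
  define I where "I = {..<N} \<times> {..<N} \<times> {..<N} \<times> {..<N}"
  define F where "F = (\<lambda>(i, j, k, m). f1 ^ i * (f2 ^ j * (f3 ^ k * f4 ^ m)))"
  have span: "F x \<in> poly3.span (monomials3 (N * D))" if "x \<in> I" for x
  proof -
    obtain i j k m where x: "x = (i, j, k, m)" by (cases x)
    have "F x \<in> poly3.span (monomials3 (i * d1 + (j * d2 + (k * d3 + m * d4))))"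
      unfolding x F_def prod.case
      by (intro span_monomials3_mult span_monomials3_power d)
    moreover have "i * d1 + (j * d2 + (k * d3 + m * d4)) \<le> N * D"
      unfolding D_def distrib_left add.assoc using that
      by (auto simp: x I_def intro!: add_mono mult_right_mono)
    ultimately show ?thesis by (rule span_monomials3_mono[rotated])
  qed
  have "card (monomials3 (N * D)) \<le> Suc (N * D) ^ 3" by (rule card_monomials3)
  also have "\<dots> \<le> (N * Suc D) ^ 3" by (intro power_mono) (auto simp: N_def)
  also have "\<dots> = N ^ 3 * Suc D ^ 3" by (rule power_mult_distrib)
  also have "\<dots> < N ^ 3 * N" by (rule mult_strict_left_mono) (auto simp: N_def)
  also have "\<dots> = card I" by (simp add: I_def card_cartesian_product power3_eq_cube)
  finally have card: "card (monomials3 (N * D)) < card I" .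
  have fin: "finite I" by (simp add: I_def)
  have "\<exists>c. (\<exists>x\<in>I. c x \<noteq> 0) \<and> (\<Sum>x\<in>I. Const3 (c x) * F x) = 0"
    by (rule poly3.linear_relation_if_card_gt[OF fin finite_monomials3 card span])
  then obtain c where c: "\<exists>x\<in>I. c x \<noteq> 0" "(\<Sum>x\<in>I. Const3 (c x) * F x) = 0"
    by (elim exE conjE)
  show thesis
  proof (rule that)
    show "\<exists>i<N. \<exists>j<N. \<exists>k<N. \<exists>m<N. c (i, j, k, m) \<noteq> 0"
      using c(1) by (auto simp: I_def)
    have "(\<Sum>i<N. f1 ^ i * (\<Sum>j<N. f2 ^ j * (\<Sum>k<N. f3 ^ k *
           (\<Sum>m<N. f4 ^ m * Const3 (c (i, j, k, m))))))
        = (\<Sum>i<N. \<Sum>j<N. \<Sum>k<N. \<Sum>m<N. Const3 (c (i, j, k, m)) * F (i, j, k, m))"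
      unfolding sum_distrib_left F_def prod.case
      by (intro sum.cong refl) (simp only: mult_ac)
    also have "\<dots> = (\<Sum>x\<in>I. Const3 (c x) * F x)"
      unfolding I_def sum.cartesian_product' ..
    finally show "(\<Sum>i<N. f1 ^ i * (\<Sum>j<N. f2 ^ j * (\<Sum>k<N. f3 ^ k *
           (\<Sum>m<N. f4 ^ m * Const3 (c (i, j, k, m)))))) = 0"
      using c(2) by simp
  qed
qed

text \<open>The sum factors as \<open>f ^ m * (g m + f * h)\<close>. On the irreducible set
  \<open>C'\<close> the power of \<open>f\<close> is not identically zero, so the second factor
  vanishes there; on \<open>C\<close>, where \<open>f\<close> is zero, it reduces to
  \<open>g m\<close>.\<close>

lemma vanishing_lowest_coefficient:
  assumes irr: "irreducible_algebraic_set C'" and sub: "C \<subseteq> C'"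
    and f: "\<And>v. v \<in> C \<Longrightarrow> value3 f v = 0" "w \<in> C'" "value3 f w \<noteq> 0"
    and eq: "\<And>v. v \<in> C' \<Longrightarrow> value3 (\<Sum>i<N. f ^ i * g i) v = 0"
    and m: "m < N" "\<And>i. i < m \<Longrightarrow> g i = 0"
    and v: "v \<in> C"
  shows "value3 (g m) v = 0"
proof -
  define h where "h = (\<Sum>i\<in>{m<..<N}. f ^ (i - m - 1) * g i)"
  have "(\<Sum>i<N. f ^ i * g i) = (\<Sum>i\<in>{m..<N}. f ^ i * g i)"
    using m by (intro sum.mono_neutral_right) auto
  also have "{m..<N} = insert m {m<..<N}" using m by auto
  also have "(\<Sum>i\<in>\<dots>. f ^ i * g i) = f ^ m * g m + (\<Sum>i\<in>{m<..<N}. f ^ i * g i)"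
    by (subst sum.insert) auto
  also have "(\<Sum>i\<in>{m<..<N}. f ^ i * g i) = f ^ m * (f * h)"
    unfolding h_def sum_distrib_left
  proof (rule sum.cong[OF refl])
    fix i assume "i \<in> {m<..<N}"
    then have "i = m + Suc (i - m - 1)" by auto
    then have "f ^ i = f ^ m * (f * f ^ (i - m - 1))" by (metis power_add power_Suc)
    then show "f ^ i * g i = f ^ m * (f * (f ^ (i - m - 1) * g i))" by (simp add: mult_ac)
  qed
  finally have fac: "(\<Sum>i<N. f ^ i * g i) = f ^ m * (g m + f * h)"
    by (simp add: algebra_simps)
  have "(\<forall>v\<in>C'. value3 (f ^ m) v = 0) \<or> (\<forall>v\<in>C'. value3 (g m + f * h) v = 0)"
    using eq by (intro irreducible_algebraic_setD[OF irr]) (simp add: fac value3.hom_mult)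
  then have "value3 (g m + f * h) v = 0"
    using f(2,3) v sub by (auto simp: value3.hom_power)
  then show ?thesis using f(1)[OF v] by (simp add: value3.hom_add value3.hom_mult)
qed

text \<open>An algebraic relation between the four separating polynomials holds on
  \<open>C4\<close>. Each step down the chain replaces it by its lowest nonzero coefficient, until a
  nonzero constant would vanish on the nonempty set \<open>C0\<close>.\<close>

lemma no_irreducible_chain_of_length_4:
  assumes irr: "irreducible_algebraic_set C0" "irreducible_algebraic_set C1"
      "irreducible_algebraic_set C2" "irreducible_algebraic_set C3" "irreducible_algebraic_set C4"
    and sub: "C0 \<subset> C1" "C1 \<subset> C2" "C2 \<subset> C3" "C3 \<subset> C4"
  shows False
proof -
  have alg: "algebraic_set C0" "algebraic_set C1" "algebraic_set C2" "algebraic_set C3"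
    using irr by (auto simp: irreducible_algebraic_set_def)
  obtain f1 v1 where f1: "\<And>u. u \<in> C3 \<Longrightarrow> value3 f1 u = 0" "v1 \<in> C4" "value3 f1 v1 \<noteq> 0"
    using algebraic_subset_separate[OF alg(4) sub(4)] by blast
  obtain f2 v2 where f2: "\<And>u. u \<in> C2 \<Longrightarrow> value3 f2 u = 0" "v2 \<in> C3" "value3 f2 v2 \<noteq> 0"
    using algebraic_subset_separate[OF alg(3) sub(3)] by blast
  obtain f3 v3 where f3: "\<And>u. u \<in> C1 \<Longrightarrow> value3 f3 u = 0" "v3 \<in> C2" "value3 f3 v3 \<noteq> 0"
    using algebraic_subset_separate[OF alg(2) sub(2)] by blast
  obtain f4 v4 where f4: "\<And>u. u \<in> C0 \<Longrightarrow> value3 f4 u = 0" "v4 \<in> C1" "value3 f4 v4 \<noteq> 0"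
    using algebraic_subset_separate[OF alg(1) sub(1)] by blast
  obtain N c where c: "\<exists>i<N. \<exists>j<N. \<exists>k<N. \<exists>m<N. c i j k m \<noteq> 0"
    and rel: "(\<Sum>i<N. f1 ^ i * (\<Sum>j<N. f2 ^ j * (\<Sum>k<N. f3 ^ k *
           (\<Sum>m<N. f4 ^ m * Const3 (c i j k m))))) = 0"
    by (rule four_polynomials_algebraically_dependent)
  have least: "\<exists>i<N. P i \<and> (\<forall>j<i. \<not> P j)" if "\<exists>i<N. P i" for P :: "nat \<Rightarrow> bool"
    using that exists_least_iff[of P] by (metis less_trans linorder_neqE_nat)
  \<comment> \<open>The tuple \<open>(i, j, k, m)\<close> is the lexicographically least one with a
    nonzero coefficient.\<close>
  obtain i where i: "i < N" "\<exists>j<N. \<exists>k<N. \<exists>m<N. c i j k m \<noteq> 0"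
    "\<And>i'. i' < i \<Longrightarrow> \<not> (\<exists>j<N. \<exists>k<N. \<exists>m<N. c i' j k m \<noteq> 0)"
    using least[OF c] by blast
  obtain j where j: "j < N" "\<exists>k<N. \<exists>m<N. c i j k m \<noteq> 0"
    "\<And>j'. j' < j \<Longrightarrow> \<not> (\<exists>k<N. \<exists>m<N. c i j' k m \<noteq> 0)"
    using least[OF i(2)] by blast
  obtain k where k: "k < N" "\<exists>m<N. c i j k m \<noteq> 0"
    "\<And>k'. k' < k \<Longrightarrow> \<not> (\<exists>m<N. c i j k' m \<noteq> 0)"
    using least[OF j(2)] by blast
  obtain m where m: "m < N" "c i j k m \<noteq> 0" "\<And>m'. m' < m \<Longrightarrow> \<not> (c i j k m' \<noteq> 0)"
    using least[OF k(2)] by blast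
  have 0: "Const3 0 = 0" by (simp add: Const3_def)
  have e3: "value3 (\<Sum>j<N. f2 ^ j * (\<Sum>k<N. f3 ^ k * (\<Sum>m<N. f4 ^ m * Const3 (c i j k m)))) v = 0" if "v \<in> C3" for v
  proof (rule vanishing_lowest_coefficient[OF irr(5) psubset_imp_subset[OF sub(4)] f1 _ i(1) _ that])
    fix i' assume "i' < i"
    from i(3)[OF this] show "(\<Sum>j<N. f2 ^ j * (\<Sum>k<N. f3 ^ k * (\<Sum>m<N. f4 ^ m * Const3 (c i' j k m)))) = 0"
      by (simp add: 0)
  qed (simp_all add: rel)
  have e2: "value3 (\<Sum>k<N. f3 ^ k * (\<Sum>m<N. f4 ^ m * Const3 (c i j k m))) v = 0" if "v \<in> C2" for v
  proof (rule vanishing_lowest_coefficient[OF irr(4) psubset_imp_subset[OF sub(3)] f2 _ j(1) _ that])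
    fix j' assume "j' < j"
    from j(3)[OF this] show "(\<Sum>k<N. f3 ^ k * (\<Sum>m<N. f4 ^ m * Const3 (c i j' k m))) = 0"
      by (simp add: 0)
  qed (simp_all add: e3)
  have e1: "value3 (\<Sum>m<N. f4 ^ m * Const3 (c i j k m)) v = 0" if "v \<in> C1" for v
  proof (rule vanishing_lowest_coefficient[OF irr(3) psubset_imp_subset[OF sub(2)] f3 _ k(1) _ that])
    fix k' assume "k' < k"
    from k(3)[OF this] show "(\<Sum>m<N. f4 ^ m * Const3 (c i j k' m)) = 0"
      by (simp add: 0)
  qed (simp_all add: e2)
  have e0: "value3 (Const3 (c i j k m)) v = 0" if "v \<in> C0" for v
  proof (rule vanishing_lowest_coefficient[OF irr(2) psubset_imp_subset[OF sub(1)] f4 _ m(1) _ that])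
    fix m' assume "m' < m"
    from m(3)[OF this] show "Const3 (c i j k m') = 0"
      by (simp add: 0)
  qed (simp_all add: e1)
  obtain v where "v \<in> C0" using irr(1) by (auto simp: irreducible_algebraic_set_def)
  then show False using e0[of v] m(2) by (cases v) simp
qed

text \<open>The chain \<open>{v}\<close>, \<open>C\<close>, \<open>zero_locus {p}\<close> bounds the
  dimension from below. From above, a chain of length 3 inside the locus would extend by the whole
  space to one of length 4.\<close>

lemma irreducible_affine_surface_hypersurface:
  assumes irr: "irreducible p" and deg: "degree p > 0"
    and C: "irreducible_algebraic_set C" "C \<subset> zero_locus {p}" "v \<in> C" "C \<noteq> {v}"
  shows "irreducible_affine_surface (zero_locus {p})"
  unfolding irreducible_affine_surface_def
proof
  show S: "irreducible_algebraic_set (zero_locus {p})"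
    using irr deg by (rule irreducible_hypersurface)
  show "algebraic_dim (zero_locus {p}) = 2"
    unfolding algebraic_dim_def
  proof (rule antisym)
    show "Sup {enat n | n. \<exists>C :: nat \<Rightarrow> (complex \<times> complex \<times> complex) set.
            (\<forall>i\<le>n. irreducible_algebraic_set (C i) \<and> C i \<subseteq> zero_locus {p}) \<and>
            (\<forall>i<n. C i \<subset> C (Suc i))} \<le> 2"
    proof (rule Sup_least, clarify)
      fix n and D :: "nat \<Rightarrow> (complex \<times> complex \<times> complex) set"
      assume D: "\<forall>i\<le>n. irreducible_algebraic_set (D i) \<and> D i \<subseteq> zero_locus {p}"
        and ss: "\<forall>i<n. D i \<subset> D (Suc i)"
      have "n \<le> 2"
      proof (rule ccontr)
        assume "\<not> n \<le> 2"
        then have n: "0 < n" "1 < n" "2 < n" by auto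
        obtain w where "w \<notin> zero_locus {p}"
          using irr value3_eq_0_imp_eq_0[of p] by (auto simp: zero_locus_def)
        then have "w \<notin> D 3" using D[rule_format, of 3] n by auto
        then have "D 3 \<subset> UNIV" by blast
        then show False
          using D ss n
          by (intro no_irreducible_chain_of_length_4[of "D 0" "D 1" "D 2" "D 3" UNIV])
            (auto simp: irreducible_algebraic_set_UNIV numeral_eq_Suc)
      qed
      then show "enat n \<le> 2" by (simp add: numeral_eq_enat)
    qed
    define D where "D i = (if i = 0 then {v} else if i = 1 then C else zero_locus {p})" for i :: nat
    have "(\<forall>i\<le>2. irreducible_algebraic_set (D i) \<and> D i \<subseteq> zero_locus {p}) \<and>
            (\<forall>i<2. D i \<subset> D (Suc i))"
      using S C irreducible_algebraic_set_singleton[of v]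
      by (auto simp: D_def less_2_cases_iff)
    then show "2 \<le> Sup {enat n | n. \<exists>C :: nat \<Rightarrow> (complex \<times> complex \<times> complex) set.
            (\<forall>i\<le>n. irreducible_algebraic_set (C i) \<and> C i \<subseteq> zero_locus {p}) \<and>
            (\<forall>i<n. C i \<subset> C (Suc i))}"
      by (intro Sup_upper) (auto simp: numeral_eq_enat)
  qed
qed

section \<open>Polynomial functions along rational maps\<close>

text \<open>\<open>R\<close> stands for any ring of functions containing the constants: polynomial
  functions of one parameter for curves, and of three variables for the change of coordinates. The
  common denominator \<open>d\<close> is raised to a power that grows along
  \<open>p\<close>.\<close>

lemma value3_clear_denominators:
  fixes R :: "('v \<Rightarrow> complex) set"
  assumes const: "\<And>c. (\<lambda>v. c) \<in> R"
    and add: "\<And>f g. f \<in> R \<Longrightarrow> g \<in> R \<Longrightarrow> (\<lambda>v. f v + g v) \<in> R"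
    and mult: "\<And>f g. f \<in> R \<Longrightarrow> g \<in> R \<Longrightarrow> (\<lambda>v. f v * g v) \<in> R"
    and d: "d \<in> R"
    and xyz: "hx \<in> R" "hy \<in> R" "hz \<in> R"
      "\<And>v. d v \<noteq> 0 \<Longrightarrow> d v * x v = hx v"
      "\<And>v. d v \<noteq> 0 \<Longrightarrow> d v * y v = hy v"
      "\<And>v. d v \<noteq> 0 \<Longrightarrow> d v * z v = hz v"
  shows "\<exists>n. \<exists>h\<in>R. \<forall>v. d v \<noteq> 0 \<longrightarrow> d v ^ n * value3 p (x v, y v, z v) = h v"
proof -
  have pow: "(\<lambda>v. d v ^ n) \<in> R" for n
    by (induction n) (simp_all add: assms(1) assms(3)[OF d])
  show ?thesis
  proof (induction p rule: poly3_induct)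
    case (Const c)
    then show ?case using const[of c] by (intro exI[of _ 0] bexI[of _ "\<lambda>_. c"]) auto
  next
    case chi
    then show ?case using xyz by (intro exI[of _ 1] bexI[of _ hx]) auto
  next
    case a
    then show ?case using xyz by (intro exI[of _ 1] bexI[of _ hy]) auto
  next
    case s
    then show ?case using xyz by (intro exI[of _ 1] bexI[of _ hz]) auto
  next
    case (add p q)
    from add.IH(1) obtain n h where h: "h \<in> R"
      "\<And>v. d v \<noteq> 0 \<Longrightarrow> d v ^ n * value3 p (x v, y v, z v) = h v" by blast
    from add.IH(2) obtain n' h' where h': "h' \<in> R"
      "\<And>v. d v \<noteq> 0 \<Longrightarrow> d v ^ n' * value3 q (x v, y v, z v) = h' v" by blast
    have "d v ^ (n + n') * value3 (p + q) (x v, y v, z v) = d v ^ n' * h v + d v ^ n * h' v"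
      if "d v \<noteq> 0" for v
      unfolding h(2)[OF that, symmetric] h'(2)[OF that, symmetric]
      by (simp add: value3.hom_add power_add algebra_simps)
    moreover have "(\<lambda>v. d v ^ n' * h v + d v ^ n * h' v) \<in> R"
      by (intro assms(2,3) pow h(1) h'(1))
    ultimately show ?case
      by (intro exI[of _ "n + n'"] bexI[of _ "\<lambda>v. d v ^ n' * h v + d v ^ n * h' v"]) blast+
  next
    case (mult p q)
    from mult.IH(1) obtain n h where h: "h \<in> R"
      "\<And>v. d v \<noteq> 0 \<Longrightarrow> d v ^ n * value3 p (x v, y v, z v) = h v" by blast
    from mult.IH(2) obtain n' h' where h': "h' \<in> R"
      "\<And>v. d v \<noteq> 0 \<Longrightarrow> d v ^ n' * value3 q (x v, y v, z v) = h' v" by blast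
    have "d v ^ (n + n') * value3 (p * q) (x v, y v, z v) = h v * h' v"
      if "d v \<noteq> 0" for v
      unfolding h(2)[OF that, symmetric] h'(2)[OF that, symmetric]
      by (simp add: value3.hom_mult power_add algebra_simps)
    moreover have "(\<lambda>v. h v * h' v) \<in> R"
      by (intro assms(3) h(1) h'(1))
    ultimately show ?case
      by (intro exI[of _ "n + n'"] bexI[of _ "\<lambda>v. h v * h' v"]) blast+
  qed
qed

text \<open>Irreducibility of a rational curve: with denominators cleared, the two functions become
  polynomials in \<open>u\<close>, and these form a domain.\<close>

lemma value3_on_rational_curve:
  fixes d hx hy hz :: "complex poly"
  assumes d: "d \<noteq> 0"
    and xyz: "\<And>u. poly d u \<noteq> 0 \<Longrightarrow> poly d u * x u = poly hx u"
      "\<And>u. poly d u \<noteq> 0 \<Longrightarrow> poly d u * y u = poly hy u"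
      "\<And>u. poly d u \<noteq> 0 \<Longrightarrow> poly d u * z u = poly hz u"
    and fg: "\<And>u. poly d u \<noteq> 0 \<Longrightarrow> value3 f (x u, y u, z u) * value3 g (x u, y u, z u) = 0"
  shows "(\<forall>u. poly d u \<noteq> 0 \<longrightarrow> value3 f (x u, y u, z u) = 0) \<or>
    (\<forall>u. poly d u \<noteq> 0 \<longrightarrow> value3 g (x u, y u, z u) = 0)"
proof -
  have clear: "\<exists>n h. \<forall>u. poly d u \<noteq> 0 \<longrightarrow> poly d u ^ n * value3 p (x u, y u, z u) = poly h u" for p
  proof -
    have const: "(\<lambda>v. c) \<in> range poly" for c :: complex
      by (intro range_eqI[of _ _ "[:c:]"]) auto
    have add: "(\<lambda>v. a v + b v) \<in> range poly" and mult: "(\<lambda>v. a v * b v) \<in> range poly"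
      if ab: "a \<in> range poly" "b \<in> range poly" for a b :: "complex \<Rightarrow> complex"
    proof -
      from ab obtain a' b' where ab: "a = poly a'" "b = poly b'" by auto
      show "(\<lambda>v. a v + b v) \<in> range poly"
        by (intro range_eqI[of _ _ "a' + b'"]) (auto simp: ab)
      show "(\<lambda>v. a v * b v) \<in> range poly"
        by (intro range_eqI[of _ _ "a' * b'"]) (auto simp: ab)
    qed
    have "\<exists>n. \<exists>h\<in>range poly. \<forall>u. poly d u \<noteq> 0 \<longrightarrow>
        poly d u ^ n * value3 p (x u, y u, z u) = h u"
      by (rule value3_clear_denominators[OF const add mult _ _ _ _ xyz]) auto
    then show ?thesis by blast
  qed
  obtain n h where h: "\<And>u. poly d u \<noteq> 0 \<Longrightarrow> poly d u ^ n * value3 f (x u, y u, z u) = poly h u"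
    using clear by blast
  obtain n' h' where h': "\<And>u. poly d u \<noteq> 0 \<Longrightarrow> poly d u ^ n' * value3 g (x u, y u, z u) = poly h' u"
    using clear by blast
  \<comment> \<open>The extra factor \<open>d\<close> covers the parameters at which the curve is
    undefined.\<close>
  have "poly (d * (h * h')) u = 0" for u
  proof (cases "poly d u = 0")
    case False
    then show ?thesis using h[OF False] h'[OF False] fg[OF False]
      by (metis mult.left_commute mult_zero_right poly_mult mult.commute)
  qed simp
  then have "d * (h * h') = 0" using poly_all_0_iff_0 by blast
  then have "h = 0 \<or> h' = 0" using d by simp
  then show ?thesis using h h' by force
qed

section \<open>The reduced determinant\<close>

text \<open>This is \<open>c + h J\<close> with \<open>J\<close> the reversal of coordinates, whose
  ones sit where the 0-based indices add up to \<open>n - 1\<close>. As \<open>J\<close> squares to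
  the identity, changing the sign of \<open>h\<close> gives the inverse up to a scalar.\<close>

definition rev_mat :: "nat \<Rightarrow> 'a \<Rightarrow> 'a \<Rightarrow> 'a::comm_ring_1 mat" where
  "rev_mat n c h = mat n n (\<lambda>(i, k). (if i = k then c else 0) + (if Suc (i + k) = n then h else 0))"

lemma mat_mult_rev_mat:
  fixes f :: "nat \<Rightarrow> nat \<Rightarrow> 'a::comm_ring_1"
  shows "mat n n (\<lambda>(i, k). f i k) * rev_mat n c h =
    mat n n (\<lambda>(i, k). c * f i k + h * f i (n - 1 - k))"
proof (rule eq_matI)
  fix i k assume "i < dim_row (mat n n (\<lambda>(i, k). c * f i k + h * f i (n - 1 - k)))"
    "k < dim_col (mat n n (\<lambda>(i, k). c * f i k + h * f i (n - 1 - k)))"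
  then have ik: "i < n" "k < n" by auto
  have "(mat n n (\<lambda>(i, k). f i k) * rev_mat n c h) $$ (i, k) =
      (\<Sum>r<n. f i r * ((if r = k then c else 0) + (if Suc (r + k) = n then h else 0)))"
    using ik by (simp add: rev_mat_def scalar_prod_def lessThan_atLeast0)
  also have "\<dots> = (\<Sum>r<n. if r = k then f i r * c else 0) +
      (\<Sum>r<n. if r = n - 1 - k then f i r * h else 0)"
    unfolding sum.distrib[symmetric] using ik by (intro sum.cong) (auto simp: algebra_simps)
  also have "\<dots> = f i k * c + f i (n - 1 - k) * h"
    using ik by (simp add: sum.delta)
  finally show "(mat n n (\<lambda>(i, k). f i k) * rev_mat n c h) $$ (i, k) =
      mat n n (\<lambda>(i, k). c * f i k + h * f i (n - 1 - k)) $$ (i, k)"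
    using ik by (simp add: mult.commute)
qed (auto simp: rev_mat_def)

lemma det_rev_mat_mult:
  "det (rev_mat n c h) * det (rev_mat n c (- h)) = (c\<^sup>2 - h\<^sup>2) ^ n"
proof -
  have "rev_mat n c h * rev_mat n c (- h) = (c\<^sup>2 - h\<^sup>2) \<cdot>\<^sub>m 1\<^sub>m n"
    unfolding rev_mat_def[of n c h]
    by (subst mat_mult_rev_mat) (auto intro!: eq_matI simp: algebra_simps power2_eq_square)
  then show ?thesis
    by (metis (no_types, lifting) det_mult det_one det_smult index_one_mat(3) mat_carrier
        mult.right_neutral rev_mat_def)
qed

text \<open>The two rows are supported in two columns and their minor there vanishes, so they are
  linearly dependent; the coefficients form a kernel vector of the transpose.\<close>

lemma det_eq_0_two_rows:
  fixes A :: "'a::field mat"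
  assumes A: "A \<in> carrier_mat n n" and ik: "i < n" "k < n" "i \<noteq> k"
    and supp: "\<And>c. c < n \<Longrightarrow> c \<noteq> p \<Longrightarrow> c \<noteq> q \<Longrightarrow> A $$ (i, c) = 0 \<and> A $$ (k, c) = 0"
    and minor: "A $$ (i, p) * A $$ (k, q) = A $$ (i, q) * A $$ (k, p)"
  shows "det A = 0"
proof -
  obtain \<alpha> \<beta> where ab: "\<alpha> \<noteq> 0 \<or> \<beta> \<noteq> 0"
    "A $$ (i, p) * \<alpha> + A $$ (k, p) * \<beta> = 0" "A $$ (i, q) * \<alpha> + A $$ (k, q) * \<beta> = 0"
  \<comment> \<open>A nonzero column of the minor, swapped and with one sign changed, gives the
    coefficients; if both columns are zero, any pair works.\<close>
  proof (cases "A $$ (i, p) = 0 \<and> A $$ (k, p) = 0")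
    case False
    then show thesis
      using minor by (intro that[of "A $$ (k, p)" "- A $$ (i, p)"]) (auto simp: mult_ac)
  next
    case True
    show thesis
    proof (cases "A $$ (i, q) = 0 \<and> A $$ (k, q) = 0")
      case True
      with \<open>A $$ (i, p) = 0 \<and> _\<close> show thesis by (intro that[of 1 1]) auto
    next
      case False
      with \<open>A $$ (i, p) = 0 \<and> _\<close> show thesis
        by (intro that[of "A $$ (k, q)" "- A $$ (i, q)"]) (auto simp: mult_ac)
    qed
  qed
  define v where "v = vec n (\<lambda>r. if r = i then \<alpha> else if r = k then \<beta> else 0)"
  have "A\<^sup>T *\<^sub>v v = 0\<^sub>v n"
  proof (rule eq_vecI)
    fix c assume "c < dim_vec (0\<^sub>v n :: 'a vec)"
    then have c: "c < n" by simp
    have "(A\<^sup>T *\<^sub>v v) $ c = (\<Sum>r<n. A $$ (r, c) * (if r = i then \<alpha> else if r = k then \<beta> else 0))"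
      using A c by (simp add: v_def scalar_prod_def lessThan_atLeast0)
    also have "\<dots> = (\<Sum>r\<in>{i, k}. A $$ (r, c) * (if r = i then \<alpha> else if r = k then \<beta> else 0))"
      using ik by (intro sum.mono_neutral_right) auto
    also have "\<dots> = A $$ (i, c) * \<alpha> + A $$ (k, c) * \<beta>" using ik by simp
    also have "\<dots> = 0" using ab supp[OF c] by (cases "c = p"; cases "c = q") auto
    finally show "(A\<^sup>T *\<^sub>v v) $ c = 0\<^sub>v n $ c" using c by simp
  qed (use A in auto)
  moreover have "v \<noteq> 0\<^sub>v n"
  proof
    assume "v = 0\<^sub>v n"
    then have "v $ i = 0" "v $ k = 0" using ik by auto
    then show False using ab(1) ik by (auto simp: v_def)
  qed
  moreover have "v \<in> carrier_vec n" by (simp add: v_def)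
  ultimately have "det A\<^sup>T = 0"
    using det_0_iff_vec_prod_zero_field[of "A\<^sup>T" n] A by auto
  then show ?thesis using det_transpose[OF A] by simp
qed

text \<open>This is \<open>b + N(t, \<sigma>)\<close>. With 0-based indices the positions
  \<open>(j, n - j)\<close> and \<open>(j, l - j)\<close> become \<open>i + k + 1 = l\<close> and
  \<open>i + k + 2 = l\<close>, and the weight \<open>j\<close> becomes
  \<open>Suc i\<close>.\<close>

definition reduced_mat :: "nat \<Rightarrow> complex \<Rightarrow> complex \<Rightarrow> complex \<Rightarrow> complex mat" where
  "reduced_mat l t \<sigma> b = mat l l (\<lambda>(i, k). (if i = k then b + of_nat (Suc i) else 0) +
     (if i + k + 1 = l then \<sigma> else 0) - (if i + k + 2 = l then t / 2 * of_nat (Suc i) else 0))"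

text \<open>The characteristic polynomial of \<open>- N\<close> makes it monic in \<open>b\<close>
  by construction. The variables \<open>t\<close>, \<open>\<sigma>\<close>, \<open>b\<close> take
  the slots of \<open>X_chi\<close>, \<open>X_a\<close>, \<open>X_s\<close>.\<close>

definition reduced_poly :: "nat \<Rightarrow> poly3" where
  "reduced_poly l = char_poly (mat l l (\<lambda>(i, k). - ((if i = k then of_nat (Suc i) else 0) +
     (if i + k + 1 = l then [:0, 1:] else 0) -
     (if i + k + 2 = l then [:[:0, 1/2:]:] * of_nat (Suc i) else 0))))"

lemma value3_reduced_poly:
  "value3 (reduced_poly l) (t, \<sigma>, b) = det (reduced_mat l t \<sigma> b)"
proof -
  have of_nat: "poly (poly (of_nat n) [:\<sigma>:]) t = of_nat n" for n
    by (simp add: of_nat_poly)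
  show ?thesis
    unfolding reduced_poly_def char_poly_def value3.hom_det[symmetric]
    by (rule arg_cong[where f = det])
      (auto intro!: eq_matI simp: char_poly_matrix_def reduced_mat_def value3_eq_poly of_nat
        simp del: of_nat_Suc)
qed

lemma degree_reduced_poly: "degree (reduced_poly l) = l"
  and lead_coeff_reduced_poly: "lead_coeff (reduced_poly l) = 1"
proof -
  have "degree (reduced_poly l) = l \<and> coeff (reduced_poly l) l = 1"
    unfolding reduced_poly_def by (rule degree_monic_char_poly) simp
  then show "degree (reduced_poly l) = l" "lead_coeff (reduced_poly l) = 1" by simp_all
qed

lemma reduced_poly_at_0: "value3 (reduced_poly l) (0, 0, b) = (\<Prod>i<l. b + of_nat (Suc i))"
proof -
  have "det (reduced_mat l 0 0 b) = prod_list (diag_mat (reduced_mat l 0 0 b))"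
    by (rule det_upper_triangular[of _ l]) (auto simp: reduced_mat_def)
  also have "\<dots> = (\<Prod>i<l. reduced_mat l 0 0 b $$ (i, i))"
    by (simp add: prod_list_diag_prod reduced_mat_def lessThan_atLeast0)
  also have "\<dots> = (\<Prod>i<l. b + of_nat (Suc i))"
    by (intro prod.cong) (auto simp: reduced_mat_def)
  finally show ?thesis by (simp add: value3_reduced_poly)
qed

text \<open>For \<open>t = 0\<close> the rows \<open>i\<close> and \<open>k\<close> meet only the
  columns \<open>i\<close> and \<open>k\<close>, and the equation of the conic says that this minor
  vanishes.\<close>

lemma reduced_poly_conic_t_0:
  assumes "i + k + 1 = l" "i \<noteq> k" "(b + of_nat (Suc i)) * (b + of_nat (Suc k)) = \<sigma>\<^sup>2"
  shows "value3 (reduced_poly l) (0, \<sigma>, b) = 0"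
  unfolding value3_reduced_poly
  by (rule det_eq_0_two_rows[of _ l i k i k])
    (use assms in \<open>auto simp: reduced_mat_def power2_eq_square add.commute\<close>)

text \<open>The same minor on the other antidiagonal, whose two entries carry the weights
  \<open>Suc i\<close> and \<open>Suc k\<close>.\<close>

lemma reduced_poly_conic_\<sigma>_0:
  assumes "i + k + 2 = l" "i \<noteq> k"
    "(b + of_nat (Suc i)) * (b + of_nat (Suc k)) = t\<^sup>2 / 4 * (of_nat (Suc i) * of_nat (Suc k))"
  shows "value3 (reduced_poly l) (t, 0, b) = 0"
  unfolding value3_reduced_poly
  by (rule det_eq_0_two_rows[of _ l i k i k])
    (use assms in \<open>auto simp: reduced_mat_def power2_eq_square add.commute simp del: of_nat_Suc\<close>)

section \<open>Factors of the reduced polynomial on the line \<open>t = \<sigma> = 0\<close>\<close>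

definition axis_poly :: "poly3 \<Rightarrow> complex poly" where
  "axis_poly p = map_poly (\<lambda>q. poly (poly q 0) 0) p"

lemma coeff_axis_poly: "coeff (axis_poly p) n = poly (poly (coeff p n) 0) 0"
  by (simp add: axis_poly_def coeff_map_poly)

lemma poly_axis_poly: "poly (axis_poly p) b = value3 p (0, 0, b)"
proof -
  interpret ev: comm_ring_hom "\<lambda>q :: complex poly poly. poly (poly q 0) 0"
    by unfold_locales simp_all
  show ?thesis
    using ev.poly_map_poly[of p "[:[:b:]:]"] by (simp add: axis_poly_def value3_eq_poly)
qed

text \<open>If both factors vanished, \<open>L\<close> would divide the product of distinct linear
  factors twice; cancelling one \<open>L\<close> leaves a product that is nonzero at the
  root.\<close>

lemma simple_root_exclusive:
  assumes AB: "A * B = reduced_poly l" and i: "i < l"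
  shows "value3 A (0, 0, - of_nat (Suc i)) \<noteq> 0 \<or> value3 B (0, 0, - of_nat (Suc i)) \<noteq> 0"
proof (rule ccontr)
  assume both: "\<not> (value3 A (0, 0, - of_nat (Suc i)) \<noteq> 0 \<or> value3 B (0, 0, - of_nat (Suc i)) \<noteq> 0)"
  have root: "poly (axis_poly A) (- of_nat (Suc i)) = 0" "poly (axis_poly B) (- of_nat (Suc i)) = 0"
    using both by (auto simp: poly_axis_poly simp del: of_nat_Suc)
  define L where "L = [:of_nat (Suc i), 1 :: complex:]"
  have L: "[:- (- of_nat (Suc i)), 1:] = L" by (simp add: L_def)
  obtain A' B' where A': "axis_poly A = L * A'" and B': "axis_poly B = L * B'"
    using root unfolding poly_eq_0_iff_dvd L by (auto elim!: dvdE)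
  have "poly (axis_poly A * axis_poly B) b = poly (\<Prod>k<l. [:of_nat (Suc k), 1:]) b" for b
    using reduced_poly_at_0[of l b] unfolding AB[symmetric]
    by (simp add: poly_axis_poly value3.hom_mult poly_prod add.commute)
  then have "axis_poly A * axis_poly B = (\<Prod>k<l. [:of_nat (Suc k), 1:])"
    by (simp add: poly_eq_poly_eq_iff[symmetric] fun_eq_iff)
  also have "\<dots> = L * (\<Prod>k\<in>{..<l} - {i}. [:of_nat (Suc k), 1:])"
    unfolding L_def using i by (subst prod.remove[of _ i]) auto
  finally have "L * (A' * (L * B')) = L * (\<Prod>k\<in>{..<l} - {i}. [:of_nat (Suc k), 1:])"
    by (simp add: A' B' mult_ac)
  then have "A' * (L * B') = (\<Prod>k\<in>{..<l} - {i}. [:of_nat (Suc k), 1:])"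
    by (subst (asm) mult_cancel_left) (simp add: L_def)
  then have "poly (A' * (L * B')) (- of_nat (Suc i)) =
      poly (\<Prod>k\<in>{..<l} - {i}. [:of_nat (Suc k), 1:]) (- of_nat (Suc i))" by simp
  moreover have "poly L (- of_nat (Suc i)) = 0" by (simp add: L_def)
  ultimately have "poly (\<Prod>k\<in>{..<l} - {i}. [:of_nat (Suc k), 1:]) (- of_nat (Suc i) :: complex) = 0"
    by (simp only: poly_mult mult_zero_left mult_zero_right)
  then show False by (auto simp: poly_prod)
qed

text \<open>A rational curve on which the product vanishes and which joins two of the simple roots:
  since exactly one factor vanishes at each of them, it is the same factor at both.\<close>

lemma factor_vanishes_along_conic:
  fixes \<alpha> \<beta> :: complex
  assumes AB: "A * B = reduced_poly l" and ik: "i < l" "k < l"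
    and conic: "\<And>u. u \<noteq> 0 \<Longrightarrow> value3 (reduced_poly l) (\<alpha> * (u - 1 / u), \<beta> * (u - 1 / u),
      (of_nat k - of_nat i) / 4 * (u + 1 / u) - of_nat (i + k + 2) / 2) = 0"
  shows "value3 A (0, 0, - of_nat (Suc i)) = 0 \<longleftrightarrow> value3 A (0, 0, - of_nat (Suc k)) = 0"
proof -
  define c :: complex where "c = (of_nat k - of_nat i) / 4"
  define m :: complex where "m = of_nat (i + k + 2) / 2"
  define x where "x u = \<alpha> * (u - 1 / u)" for u
  define y where "y u = \<beta> * (u - 1 / u)" for u
  define z where "z u = c * (u + 1 / u) - m" for u
  \<comment> \<open>The parameters 1 and -1 hit the two roots.\<close>
  have ends: "x 1 = 0" "y 1 = 0" "z 1 = - of_nat (Suc i)"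
    "x (- 1) = 0" "y (- 1) = 0" "z (- 1) = - of_nat (Suc k)"
    by (simp_all add: x_def y_def z_def c_def m_def add_divide_distrib diff_divide_distrib)
  have "(\<forall>u. poly [:0, 1:] u \<noteq> 0 \<longrightarrow> value3 A (x u, y u, z u) = 0) \<or>
    (\<forall>u. poly [:0, 1:] u \<noteq> 0 \<longrightarrow> value3 B (x u, y u, z u) = 0)"
  proof (rule value3_on_rational_curve)
    fix u :: complex assume "poly [:0, 1:] u \<noteq> 0"
    then have u: "u \<noteq> 0" by simp
    show "poly [:0, 1:] u * x u = poly [:- \<alpha>, 0, \<alpha>:] u"
      using u by (simp add: x_def field_simps)
    show "poly [:0, 1:] u * y u = poly [:- \<beta>, 0, \<beta>:] u"
      using u by (simp add: y_def field_simps)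
    show "poly [:0, 1:] u * z u = poly [:c, - m, c:] u"
    proof -
      have "u * (c * (u + w) - m) = c * (u * w) + u * (- m + u * c)" for w
        by (simp add: algebra_simps)
      from this[of "1 / u"] show ?thesis using u by (simp add: z_def)
    qed
    show "value3 A (x u, y u, z u) * value3 B (x u, y u, z u) = 0"
      using conic[OF u] unfolding AB[symmetric]
      by (simp only: value3.hom_mult x_def y_def z_def c_def m_def)
  qed simp
  then show ?thesis
  proof
    assume "\<forall>u. poly [:0, 1:] u \<noteq> 0 \<longrightarrow> value3 A (x u, y u, z u) = 0"
    from this[rule_format, of 1] this[rule_format, of "- 1"] show ?thesis
      by (simp add: ends del: of_nat_Suc)
  next
    \<comment> \<open>If \<open>B\<close> vanishes along the curve, then by simplicity of the roots
      \<open>A\<close> is nonzero at both ends.\<close>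
    assume "\<forall>u. poly [:0, 1:] u \<noteq> 0 \<longrightarrow> value3 B (x u, y u, z u) = 0"
    from this[rule_format, of 1] this[rule_format, of "- 1"] show ?thesis
      using simple_root_exclusive[OF AB ik(1)] simple_root_exclusive[OF AB ik(2)]
      by (simp add: ends del: of_nat_Suc)
  qed
qed

text \<open>Centred at the midpoint of the two roots, the left side is a difference of squares, and
  \<open>(u + 1 / u)\<^sup>2 - 4 = (u - 1 / u)\<^sup>2\<close>.\<close>

lemma conic_parametrization:
  fixes u :: complex
  assumes "u \<noteq> 0" "b = (of_nat k - of_nat i) / 4 * (u + 1 / u) - of_nat (i + k + 2) / 2"
  shows "(b + of_nat (Suc i)) * (b + of_nat (Suc k)) = ((of_nat k - of_nat i) / 4 * (u - 1 / u))\<^sup>2"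
proof -
  define c :: complex where "c = (of_nat k - of_nat i) / 4"
  have mid: "of_nat (i + k + 2) / 2 = of_nat (Suc i) + 2 * c"
    "of_nat (i + k + 2) / 2 = of_nat (Suc k) - 2 * c"
    by (simp_all add: c_def field_simps)
  have b: "b = c * (u + 1 / u) - of_nat (i + k + 2) / 2"
    unfolding c_def by (rule assms(2))
  have "b + of_nat (Suc i) = c * (u + 1 / u) - 2 * c"
    unfolding b mid(1) by simp
  moreover have "b + of_nat (Suc k) = c * (u + 1 / u) + 2 * c"
    unfolding b mid(2) by simp
  moreover have "(c * (u + 1 / u) - 2 * c) * (c * (u + 1 / u) + 2 * c) = c\<^sup>2 * ((u + 1 / u)\<^sup>2 - 4)"
    by (simp add: power2_eq_square algebra_simps)
  moreover have "(u + 1 / u)\<^sup>2 - 4 = (u - 1 / u)\<^sup>2"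
  proof -
    have "(u + w)\<^sup>2 - 4 * (u * w) = (u - w)\<^sup>2" for w
      by (simp add: power2_eq_square algebra_simps)
    from this[of "1 / u"] show ?thesis using assms(1) by simp
  qed
  ultimately show ?thesis unfolding c_def[symmetric] by (simp only: power_mult_distrib)
qed

lemma factor_vanishes_at_reflections:
  assumes AB: "A * B = reduced_poly l"
    and ik: "i + k + 1 = l \<or> i + k + 2 = l"
  shows "value3 A (0, 0, - of_nat (Suc i)) = 0 \<longleftrightarrow> value3 A (0, 0, - of_nat (Suc k)) = 0"
proof (cases "i = k")
  case False
  have l: "i < l" "k < l" using ik by auto
  let ?c = "(of_nat k - of_nat i) / 4 :: complex"
  show ?thesis using ik
  proof
    assume eq: "i + k + 1 = l"
    show ?thesis
    proof (rule factor_vanishes_along_conic[OF AB l, of 0 ?c])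
      fix u :: complex assume "u \<noteq> 0"
      then show "value3 (reduced_poly l) (0 * (u - 1 / u), ?c * (u - 1 / u),
          ?c * (u + 1 / u) - of_nat (i + k + 2) / 2) = 0"
        using reduced_poly_conic_t_0[OF eq False conic_parametrization[OF _ refl]] by simp
    qed
  next
    assume eq: "i + k + 2 = l"
    \<comment> \<open>On this conic \<open>t\<^sup>2 r\<^sup>2 / 4\<close> must equal the square
      from the parametrization, so a square root of the weights yields \<open>t\<close> as a
      multiple of \<open>u - 1 / u\<close>.\<close>
    define r where "r = csqrt (of_nat (Suc i) * of_nat (Suc k))"
    have r2: "r\<^sup>2 = of_nat (Suc i) * of_nat (Suc k)" unfolding r_def by (rule power2_csqrt)
    have r0: "r \<noteq> 0"
    proof
      assume "r = 0"
      then have "of_nat (Suc i) * of_nat (Suc k) = (0 :: complex)" using r2 by simp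
      then show False by (simp del: of_nat_Suc)
    qed
    have sq: "(c * w)\<^sup>2 = (2 * c / r * w)\<^sup>2 / 4 * r\<^sup>2" if "r \<noteq> 0" for c w :: complex
      using that by (simp add: power_mult_distrib power_divide)
    show ?thesis
    proof (rule factor_vanishes_along_conic[OF AB l, of "2 * ?c / r" 0])
      fix u :: complex assume u: "u \<noteq> 0"
      have "(?c * (u - 1 / u))\<^sup>2 = (2 * ?c / r * (u - 1 / u))\<^sup>2 / 4 * (of_nat (Suc i) * of_nat (Suc k))"
        unfolding r2[symmetric] using r0 by (rule sq)
      then show "value3 (reduced_poly l) (2 * ?c / r * (u - 1 / u), 0 * (u - 1 / u),
          ?c * (u + 1 / u) - of_nat (i + k + 2) / 2) = 0"
        using reduced_poly_conic_\<sigma>_0[OF eq False trans[OF conic_parametrization[OF u refl]]] by simp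
    qed
  qed
qed simp

text \<open>The two reflections compose to a shift: \<open>i\<close> goes to
  \<open>l - 2 - i\<close> and this goes to \<open>Suc i\<close>.\<close>

lemma factor_vanishes_at_all_or_none:
  assumes AB: "A * B = reduced_poly l" and i: "i < l"
  shows "value3 A (0, 0, - of_nat (Suc i)) = 0 \<longleftrightarrow> value3 A (0, 0, - of_nat (Suc 0)) = 0"
  using i
proof (induction i)
  case (Suc i)
  define k where "k = l - 2 - i"
  have "i + k + 2 = l" "k + Suc i + 1 = l" using Suc.prems by (auto simp: k_def)
  then show ?case
    using factor_vanishes_at_reflections[OF AB, of i k] factor_vanishes_at_reflections[OF AB, of k "Suc i"]
      Suc by auto
qed simp

text \<open>On the line every root of \<open>A\<close> is a root of the product, so \<open>A\<close>
  has none and is constant there. Its leading coefficient is a unit because the product is monic, so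
  restriction preserves the degree and \<open>A\<close> is that unit.\<close>

lemma factor_unit_if_nonvanishing:
  assumes AB: "A * B = reduced_poly l"
    and nz: "\<And>i. i < l \<Longrightarrow> value3 A (0, 0, - of_nat (Suc i)) \<noteq> 0"
  shows "A dvd 1"
proof -
  have "lead_coeff A * lead_coeff B = 1"
    using lead_coeff_reduced_poly[of l] by (simp add: AB[symmetric] lead_coeff_mult)
  then have lc: "lead_coeff A dvd 1" by (metis dvd_triv_left)
  have "poly (axis_poly A) b \<noteq> 0" for b
  proof
    assume "poly (axis_poly A) b = 0"
    then have A0: "value3 A (0, 0, b) = 0" by (simp add: poly_axis_poly)
    then have "value3 (reduced_poly l) (0, 0, b) = 0"
      by (simp add: AB[symmetric] value3.hom_mult)
    then obtain i where "i < l" "b + of_nat (Suc i) = 0"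
      by (auto simp: reduced_poly_at_0 simp del: of_nat_Suc)
    then have "i < l" "b = - of_nat (Suc i)" by (auto simp: add_eq_0_iff2 simp del: of_nat_Suc)
    then show False using nz A0 by simp
  qed
  then have "constant (poly (axis_poly A))"
    using fundamental_theorem_of_algebra by blast
  then have "degree (axis_poly A) = 0" by (simp add: constant_degree)
  moreover have "coeff (axis_poly A) (degree A) \<noteq> 0"
  proof -
    obtain k where k: "lead_coeff A * k = 1" using lc by (metis dvdE)
    have "poly (poly (lead_coeff A) 0) 0 * poly (poly k 0) 0 = 1"
      unfolding poly_mult[symmetric] k by simp
    then show ?thesis by (auto simp: coeff_axis_poly)
  qed
  ultimately have "degree A = 0" using le_degree[of "axis_poly A" "degree A"] by simp
  then obtain a where a: "A = [:a:]" by (metis degree_eq_zeroE)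
  then show ?thesis using lc by (simp add: is_unit_const_poly_iff)
qed

lemma irreducible_reduced_poly:
  assumes l: "l \<ge> 1"
  shows "irreducible (reduced_poly l)"
proof (rule irreducibleI)
  show "reduced_poly l \<noteq> 0"
    using degree_reduced_poly[of l] l by auto
  show "\<not> reduced_poly l dvd 1"
    using dvd_imp_degree_le[of "reduced_poly l" 1] degree_reduced_poly[of l] l by auto
  fix A B assume "reduced_poly l = A * B"
  then have AB: "A * B = reduced_poly l" and BA: "B * A = reduced_poly l"
    by (simp_all add: mult.commute)
  show "A dvd 1 \<or> B dvd 1"
  proof (cases "value3 A (0, 0, - of_nat (Suc 0)) = 0")
    case True
    then have "value3 B (0, 0, - of_nat (Suc 0)) \<noteq> 0"
      using simple_root_exclusive[OF AB, of 0] l by auto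
    then show ?thesis
      using factor_unit_if_nonvanishing[OF BA] factor_vanishes_at_all_or_none[OF BA] by blast
  next
    case False
    then show ?thesis
      using factor_unit_if_nonvanishing[OF AB] factor_vanishes_at_all_or_none[OF AB] by blast
  qed
qed

section \<open>The reduction of the determinants\<close>

text \<open>The value of \<open>G1 + G2\<close> at a point, with 0-based indices. The entries are
  sums because the nonzero positions of both matrices may coincide.\<close>

definition P_mat :: "nat \<Rightarrow> complex \<Rightarrow> complex \<Rightarrow> complex \<Rightarrow> complex mat" where
  "P_mat l \<chi> a s = mat (Suc l) (Suc l) (\<lambda>(i, k). if i < l then
     (if k = i then s / 2 else 0) + (if k = Suc i then \<chi> * a - of_nat (Suc i) else 0) +
     (if i + k + 1 = l then a / 2 else 0) + (if i + k = l then \<chi> * s else 0)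
     else (if k = l then 1 / 2 else 0) + (if k = 0 then \<chi> else 0))"

lemma value3_G1_entry:
  assumes "i \<le> l" "k \<le> l"
  shows "value3 (G1_entry l (Suc i) (Suc k)) (\<chi>, a, s) = (if i < l then
     (if k = i then s / 2 else 0) + (if k = Suc i then \<chi> * a - of_nat (Suc i) else 0)
     else if k = l then 1 / 2 else 0)"
proof (cases "i < l")
  case True
  then show ?thesis
    by (cases "k = i"; cases "k = Suc i")
      (simp_all add: G1_entry_def value3.hom_mult value3.hom_minus value3.hom_of_nat del: of_nat_Suc)
next
  case False
  then show ?thesis using assms by (simp add: G1_entry_def)
qed

lemma value3_G2_entry:
  assumes "i \<le> l" "k \<le> l" "l \<ge> 1"
  shows "value3 (G2_entry l (Suc i) (Suc k)) (\<chi>, a, s) = (if i < l then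
     (if i + k + 1 = l then a / 2 else 0) + (if i + k = l then \<chi> * s else 0)
     else if k = 0 then \<chi> else 0)"
proof (cases "i < l")
  case True
  then have "Suc k = l + 1 - Suc i \<longleftrightarrow> i + k + 1 = l" "Suc k = l + 2 - Suc i \<longleftrightarrow> i + k = l"
    using assms by auto
  then show ?thesis using True
    by (cases "i + k + 1 = l"; cases "i + k = l")
      (simp_all add: G2_entry_def value3.hom_mult)
next
  case False
  then show ?thesis using assms by (simp add: G2_entry_def)
qed

lemma value3_P_plus:
  assumes "l \<ge> 1"
  shows "value3 (P_plus l) (\<chi>, a, s) = det (P_mat l \<chi> a s)"
proof -
  have "map_mat (\<lambda>p. value3 p (\<chi>, a, s)) (G1 l + G2 l) = P_mat l \<chi> a s"
    by (rule eq_matI)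
      (simp_all add: G1_def G2_def P_mat_def value3.hom_add value3_G1_entry value3_G2_entry[OF _ _ assms]
        del: of_nat_Suc)
  then show ?thesis unfolding P_plus_def by (metis value3.hom_det)
qed

text \<open>In \<open>G1\<close> only the product of \<open>\<chi>\<close> and \<open>a\<close>
  occurs, while every entry of \<open>G2\<close> changes sign with
  \<open>(\<chi>, a)\<close>.\<close>

lemma value3_P_minus:
  assumes "l \<ge> 1"
  shows "value3 (P_minus l) (\<chi>, a, s) = det (P_mat l (- \<chi>) (- a) s)"
proof -
  have "map_mat (\<lambda>p. value3 p (\<chi>, a, s)) (G1 l - G2 l) = P_mat l (- \<chi>) (- a) s"
    by (rule eq_matI)
      (simp_all add: G1_def G2_def P_mat_def value3.hom_minus value3_G1_entry value3_G2_entry[OF _ _ assms]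
        del: of_nat_Suc)
  then show ?thesis unfolding P_minus_def by (metis value3.hom_det)
qed

text \<open>The determinants of the two column operations stay as factors. \<open>\<delta>\<close>
  comes from the corner of the last row, \<open>\<chi> ^ l\<close> from scaling the remaining
  block.\<close>

lemma det_P_mat_reduced:
  fixes \<chi> a s :: complex
  defines "\<delta> \<equiv> 1 / 4 - \<chi>\<^sup>2"
  assumes \<chi>: "\<chi> \<noteq> 0"
  shows "det (P_mat l \<chi> a s) * det (rev_mat (Suc l) (1 / 2) (- \<chi>)) * det (rev_mat l 0 1) =
    \<delta> * \<chi> ^ l * det (reduced_mat l (1 / \<chi>) (s * \<delta> / \<chi>) (a * \<delta> / \<chi>))"
proof -
  define f where "f i k = (if i < l then
     (if k = i then s / 2 else 0) + (if k = Suc i then \<chi> * a - of_nat (Suc i) else 0) +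
     (if i + k + 1 = l then a / 2 else 0) + (if i + k = l then \<chi> * s else 0)
     else (if k = l then 1 / 2 else 0) + (if k = 0 then \<chi> else 0))" for i k
  define w where "w i k = (if i = k then s * \<delta> else 0) - (if k = Suc i then of_nat (Suc i) / 2 else 0) +
    (if i + k + 1 = l then a * \<delta> + \<chi> * of_nat (Suc i) else 0)" for i k
  define W where "W = mat l l (\<lambda>(i, k). w i k)"
  \<comment> \<open>Writing the conditionals as indicator factors turns each entry computation into
    a ring identity.\<close>
  have ind: "(if b then x else 0) = x * (of_bool b :: complex)" for b x by simp
  have fw: "1 / 2 * f i k - \<chi> * f i (l - k) = (if i < l then w i k else if k = l then \<delta> else 0)"
    if "i \<le> l" "k \<le> l" for i k
  proof (cases "i < l")
    case True
    \<comment> \<open>Reversing the columns swaps the diagonal with the antidiagonal and the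
      superdiagonal with the antidiagonal next to it.\<close>
    have e: "(l - k = i) = (i + k = l)" "(l - k = Suc i) = (i + k + 1 = l)"
      "(i + (l - k) + 1 = l) = (k = Suc i)" "(i + (l - k) = l) = (k = i)" "(i = k) = (k = i)"
      using that True by auto
    define A B C D where "A = (of_bool (k = i) :: complex)" "B = (of_bool (k = Suc i) :: complex)"
      "C = (of_bool (i + k + 1 = l) :: complex)" "D = (of_bool (i + k = l) :: complex)"
    have "1 / 2 * (s / 2 * A + (\<chi> * a - j) * B + a / 2 * C + \<chi> * s * D)
        - \<chi> * (s / 2 * D + (\<chi> * a - j) * C + a / 2 * B + \<chi> * s * A)
        = s * \<delta> * A - j / 2 * B + (a * \<delta> + \<chi> * j) * C" for j
      by (simp add: \<delta>_def algebra_simps power2_eq_square)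
    then show ?thesis
      using True by (simp only: f_def w_def e ind if_True A_B_C_D_def)
  next
    case False
    have e: "(l - k = l) = (k = 0)" "(l - k = 0) = (k = l)"
      using that by auto
    have "1 / 2 * (1 / 2 * A + \<chi> * B) - \<chi> * (1 / 2 * B + \<chi> * A) = \<delta> * A" for A B
      by (simp add: \<delta>_def algebra_simps power2_eq_square)
    then show ?thesis
      using False by (simp only: f_def e ind if_False)
  qed
  have "P_mat l \<chi> a s = mat (Suc l) (Suc l) (\<lambda>(i, k). f i k)"
    by (simp only: P_mat_def f_def)
  then have "P_mat l \<chi> a s * rev_mat (Suc l) (1 / 2) (- \<chi>) =
      mat (Suc l) (Suc l) (\<lambda>(i, k). 1 / 2 * f i k - \<chi> * f i (l - k))"
    by (simp add: mat_mult_rev_mat)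
  also have "\<dots> = mat (Suc l) (Suc l) (\<lambda>(i, k). if i < l then w i k else if k = l then \<delta> else 0)"
    by (rule eq_matI) (simp_all only: fw index_mat dim_row_mat dim_col_mat prod.case less_Suc_eq_le)
  also have "\<dots> = four_block_mat W (mat l 1 (\<lambda>(i, k). w i l)) (0\<^sub>m 1 l) (mat 1 1 (\<lambda>_. \<delta>))"
    by (rule eq_matI) (auto simp: W_def less_Suc_eq)
  finally have "det (P_mat l \<chi> a s * rev_mat (Suc l) (1 / 2) (- \<chi>)) = det W * det (mat 1 1 (\<lambda>_. \<delta>))"
    by (simp only:) (rule det_four_block_mat_lower_left_zero[of _ l _ 1], auto simp: W_def)
  also have "det (mat 1 1 (\<lambda>_. \<delta>)) = \<delta>"
    by (subst det_upper_triangular[of _ 1]) (auto simp: diag_mat_def)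
  finally have 1: "det (P_mat l \<chi> a s) * det (rev_mat (Suc l) (1 / 2) (- \<chi>)) = det W * \<delta>"
    by (subst (asm) det_mult[of _ "Suc l"]) (auto simp: P_mat_def rev_mat_def)
  have W_red: "0 * w i k + 1 * w i (l - 1 - k) = \<chi> * ((if i = k then a * \<delta> / \<chi> + of_nat (Suc i) else 0) +
     (if i + k + 1 = l then s * \<delta> / \<chi> else 0) -
     (if i + k + 2 = l then 1 / \<chi> / 2 * of_nat (Suc i) else 0))"
    if "i < l" "k < l" for i k
  proof -
    have e: "(i = l - 1 - k) = (i + k + 1 = l)" "(l - 1 - k = Suc i) = (i + k + 2 = l)"
      "(i + (l - 1 - k) + 1 = l) = (i = k)"
      using that by auto
    show ?thesis
      using \<chi> by (simp only: w_def e ind) (simp add: algebra_simps del: of_nat_Suc)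
  qed
  have "W * rev_mat l 0 1 = \<chi> \<cdot>\<^sub>m reduced_mat l (1 / \<chi>) (s * \<delta> / \<chi>) (a * \<delta> / \<chi>)"
    unfolding W_def mat_mult_rev_mat reduced_mat_def
    by (rule eq_matI) (simp_all only: W_red index_mat dim_row_mat dim_col_mat prod.case index_smult_mat)
  then have 2: "det W * det (rev_mat l 0 1) = \<chi> ^ l * det (reduced_mat l (1 / \<chi>) (s * \<delta> / \<chi>) (a * \<delta> / \<chi>))"
    by (subst det_mult[of _ l, symmetric]) (auto simp: W_def rev_mat_def reduced_mat_def)
  show ?thesis
    unfolding 1 mult.assoc[of \<delta>] 2[symmetric] by (simp only: mult_ac)
qed

lemma det_rev_mat_0_1: "det (rev_mat l 0 (1::complex)) \<noteq> 0"
  using det_rev_mat_mult[of l 0 "1::complex"] by auto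

text \<open>For \<open>a = s = 0\<close> the first column has the single entry \<open>\<chi>\<close>
  in the last row, and the remaining minor is diagonal.\<close>

lemma det_P_mat_axis:
  assumes l: "l \<ge> 1"
  obtains c where "c \<noteq> 0" "\<And>\<chi>. det (P_mat l \<chi> 0 0) = c * \<chi>"
proof
  define N where "N = mat l l (\<lambda>(i, k). if i = k then - of_nat (Suc i) else 0 :: complex)"
  define c where "c = (- 1) ^ l * det N"
  have "det N = prod_list (diag_mat N)"
    by (rule det_upper_triangular[of _ l]) (auto simp: N_def)
  then show "c \<noteq> 0"
    by (auto simp: c_def prod_list_zero_iff diag_mat_def N_def simp del: of_nat_Suc)
  show "det (P_mat l \<chi> 0 0) = c * \<chi>" for \<chi>
  proof -
    have zero: "P_mat l \<chi> 0 0 $$ (i, 0) = 0" if "i < l" for i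
      using that by (simp add: P_mat_def)
    have "det (P_mat l \<chi> 0 0) = (\<Sum>i<Suc l. P_mat l \<chi> 0 0 $$ (i, 0) * cofactor (P_mat l \<chi> 0 0) i 0)"
      by (rule laplace_expansion_column) (simp_all add: P_mat_def)
    also have "\<dots> = P_mat l \<chi> 0 0 $$ (l, 0) * cofactor (P_mat l \<chi> 0 0) l 0"
      by (simp add: zero)
    also have "cofactor (P_mat l \<chi> 0 0) l 0 = c"
    proof -
      have "mat_delete (P_mat l \<chi> 0 0) l 0 = N"
        by (rule eq_matI) (simp_all add: mat_delete_def P_mat_def N_def del: of_nat_Suc)
      then show ?thesis by (simp add: cofactor_def c_def)
    qed
    finally show ?thesis using l by (simp add: P_mat_def)
  qed
qed

lemma det_P_mat_origin_line:
  assumes "s \<noteq> 0"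
  shows "det (P_mat l 0 0 s) \<noteq> 0"
proof -
  have "det (P_mat l 0 0 s) = prod_list (diag_mat (P_mat l 0 0 s))"
    by (rule det_upper_triangular[of _ "Suc l"]) (auto simp: P_mat_def)
  moreover have "P_mat l 0 0 s $$ (i, i) = (if i < l then s / 2 else 1 / 2)" if "i < Suc l" for i
    using that by (cases "i < l") (auto simp: P_mat_def)
  then have "P_mat l 0 0 s $$ (i, i) \<noteq> 0" if "i < Suc l" for i
    using that assms by simp
  ultimately show ?thesis
    by (auto simp: prod_list_zero_iff diag_mat_def) (simp add: P_mat_def)
qed

text \<open>For \<open>s = 0\<close> the last two rows are supported in the first and last columns,
  and the equation of the curve is the vanishing of their minor.\<close>

lemma det_P_mat_curve:
  assumes l: "l \<ge> 1" and curve: "(1 / 4 - \<chi>\<^sup>2) * a + of_nat l * \<chi> = 0"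
  shows "det (P_mat l \<chi> a 0) = 0"
proof (rule det_eq_0_two_rows)
  show "P_mat l \<chi> a 0 \<in> carrier_mat (Suc l) (Suc l)" by (simp add: P_mat_def)
  show "l - 1 < Suc l" "l < Suc l" "l - 1 \<noteq> l" using l by auto
  show "P_mat l \<chi> a 0 $$ (l - 1, c) = 0 \<and> P_mat l \<chi> a 0 $$ (l, c) = 0"
    if "c < Suc l" "c \<noteq> 0" "c \<noteq> l" for c
    using that l by (auto simp: P_mat_def)
  have e: "P_mat l \<chi> a 0 $$ (l - 1, 0) = a / 2" "P_mat l \<chi> a 0 $$ (l, l) = 1 / 2"
    "P_mat l \<chi> a 0 $$ (l - 1, l) = \<chi> * a - of_nat l" "P_mat l \<chi> a 0 $$ (l, 0) = \<chi>"
    using l by (auto simp: P_mat_def)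
  show "P_mat l \<chi> a 0 $$ (l - 1, 0) * P_mat l \<chi> a 0 $$ (l, l) =
      P_mat l \<chi> a 0 $$ (l - 1, l) * P_mat l \<chi> a 0 $$ (l, 0)"
    unfolding e using curve by (simp add: algebra_simps power2_eq_square)
qed

section \<open>Polynomials in the innermost variable and the inverse change of coordinates\<close>

text \<open>These are the factors that clearing denominators may introduce. Excluding zero makes the
  class closed under divisors as well as products.\<close>

definition chi_poly :: "poly3 \<Rightarrow> bool" where
  "chi_poly p \<longleftrightarrow> (\<exists>r. r \<noteq> 0 \<and> p = [:[:r:]:])"

lemma chi_poly_mult_iff: "chi_poly (p * q) \<longleftrightarrow> chi_poly p \<and> chi_poly q"
proof
  assume "chi_poly (p * q)"
  then obtain r where r: "r \<noteq> 0" "p * q = [:[:r:]:]" by (auto simp: chi_poly_def)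
  have const: "\<exists>c d. u = [:c:] \<and> v = [:d:] \<and> c * d = w" if "u * v = [:w:]" "w \<noteq> 0"
    for u v :: "'a::idom poly" and w
  proof -
    have "u \<noteq> 0" "v \<noteq> 0" using that by auto
    then have "degree u = 0" "degree v = 0"
      using degree_mult_eq[of u v] that by auto
    then obtain c d where "u = [:c:]" "v = [:d:]" by (metis degree_eq_zeroE)
    then show ?thesis using that by (simp add: mult.commute)
  qed
  obtain c d where cd: "p = [:c:]" "q = [:d:]" "c * d = [:r:]"
    using const[OF r(2)] r(1) by auto
  obtain c' d' where "c = [:c':]" "d = [:d':]" "c' * d' = r"
    using const[OF cd(3) r(1)] by auto
  then show "chi_poly p \<and> chi_poly q"
    using cd r(1) by (auto simp: chi_poly_def)
qed (auto simp: chi_poly_def)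

lemma chi_poly_power: "chi_poly p \<Longrightarrow> chi_poly (p ^ n)"
proof (induction n)
  case 0
  have "1 = [:[:1 :: complex poly:]:]" by (simp add: one_pCons)
  then show ?case unfolding chi_poly_def power_0 by (metis zero_neq_one)
qed (simp add: chi_poly_mult_iff)

text \<open>The prime \<open>reduced_poly l\<close> has positive degree in the outermost variable,
  so it cannot divide \<open>w\<close>.\<close>

lemma reduced_poly_dvd_chi_poly_mult:
  assumes l: "l \<ge> 1" and "chi_poly w" "reduced_poly l dvd p * w"
  shows "reduced_poly l dvd p"
proof -
  have "\<not> reduced_poly l dvd w"
    using assms dvd_imp_degree_le[of "reduced_poly l" w]
    by (auto simp: chi_poly_def degree_reduced_poly)
  then show ?thesis
    using assms irreducible_imp_prime_elem[OF irreducible_reduced_poly[OF l]]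
      prime_elem_dvd_mult_iff by blast
qed

text \<open>The coordinates of the reduced polynomial are \<open>t = 1 / \<chi>\<close>, \<open>\<sigma> = s \<delta> / \<chi>\<close> and
  \<open>b = a \<delta> / \<chi>\<close> with \<open>\<delta> = 1 / 4 - \<chi>\<^sup>2\<close>; this is their inverse.\<close>

definition original_coords :: "complex \<Rightarrow> complex \<Rightarrow> complex \<Rightarrow> complex \<times> complex \<times> complex" where
  "original_coords t \<sigma> b = (1 / t, 4 * t * b / (t\<^sup>2 - 4), 4 * t * \<sigma> / (t\<^sup>2 - 4))"

lemma original_coords_clear_denominators:
  "\<exists>n p'. \<forall>t \<sigma> b. t * (t\<^sup>2 - 4) \<noteq> 0 \<longrightarrow>
    (t * (t\<^sup>2 - 4)) ^ n * value3 p (original_coords t \<sigma> b) = value3 p' (t, \<sigma>, b)"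
proof -
  have "\<exists>n. \<exists>h\<in>range value3. \<forall>v. (case v of (t, \<sigma>, b) \<Rightarrow> t * (t\<^sup>2 - 4)) \<noteq> 0 \<longrightarrow>
    (case v of (t, \<sigma>, b) \<Rightarrow> t * (t\<^sup>2 - 4)) ^ n *
      value3 p (case v of (t, \<sigma>, b) \<Rightarrow> 1 / t, case v of (t, \<sigma>, b) \<Rightarrow> 4 * t * b / (t\<^sup>2 - 4),
        case v of (t, \<sigma>, b) \<Rightarrow> 4 * t * \<sigma> / (t\<^sup>2 - 4)) = h v"
  proof (rule value3_clear_denominators)
    show "(\<lambda>v. c) \<in> range value3" for c
      by (rule range_eqI[of _ _ "Const3 c"]) auto
    show "(\<lambda>v. f v + g v) \<in> range value3" if "f \<in> range value3" "g \<in> range value3" for f g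
    proof -
      from that obtain p q where "f = value3 p" "g = value3 q" by auto
      then show ?thesis
        by (intro range_eqI[of _ _ "p + q"]) (simp add: fun_eq_iff value3.hom_add)
    qed
    show "(\<lambda>v. f v * g v) \<in> range value3" if "f \<in> range value3" "g \<in> range value3" for f g
    proof -
      from that obtain p q where "f = value3 p" "g = value3 q" by auto
      then show ?thesis
        by (intro range_eqI[of _ _ "p * q"]) (simp add: fun_eq_iff value3.hom_mult)
    qed
    show "(\<lambda>v. case v of (t, \<sigma>, b) \<Rightarrow> t * (t\<^sup>2 - 4)) \<in> range value3"
      by (rule range_eqI[of _ _ "X_chi * (X_chi\<^sup>2 - Const3 4)"])
        (auto simp: value3.hom_mult value3.hom_minus value3.hom_power)
    show "value3 (X_chi\<^sup>2 - Const3 4) \<in> range value3"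
      "value3 (Const3 4 * X_chi\<^sup>2 * X_s) \<in> range value3"
      "value3 (Const3 4 * X_chi\<^sup>2 * X_a) \<in> range value3" by simp_all
  qed (auto simp: value3.hom_mult value3.hom_minus value3.hom_power power2_eq_square)
  then obtain n p' where "\<forall>v. (case v of (t, \<sigma>, b) \<Rightarrow> t * (t\<^sup>2 - 4)) \<noteq> 0 \<longrightarrow>
    (case v of (t, \<sigma>, b) \<Rightarrow> t * (t\<^sup>2 - 4)) ^ n *
      value3 p (case v of (t, \<sigma>, b) \<Rightarrow> 1 / t, case v of (t, \<sigma>, b) \<Rightarrow> 4 * t * b / (t\<^sup>2 - 4),
        case v of (t, \<sigma>, b) \<Rightarrow> 4 * t * \<sigma> / (t\<^sup>2 - 4)) = value3 p' v"
    by blast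
  then show ?thesis
    by (intro exI[of _ n] exI[of _ p']) (auto simp: original_coords_def)
qed

text \<open>Since \<open>G'\<close> involves only \<open>t\<close>, the values of \<open>G\<close>
  depend only on \<open>\<chi> = 1 / t\<close> wherever the coordinate change is defined.
  Multiplying by the excluded factors makes this a polynomial identity.\<close>

lemma chi_poly_if_cleared:
  assumes G': "chi_poly G'"
    and eq: "\<And>t \<sigma> b. t * (t\<^sup>2 - 4) \<noteq> 0 \<Longrightarrow>
      (t * (t\<^sup>2 - 4)) ^ n * value3 G (original_coords t \<sigma> b) = value3 G' (t, \<sigma>, b)"
  obtains w where "G = [:[:w:]:]"
proof -
  define w where "w = poly (poly G 0) 0"
  obtain r where r: "G' = [:[:r:]:]" using G' by (auto simp: chi_poly_def)
  have "X_chi * ((X_chi\<^sup>2 - Const3 (1 / 4)) * (G - [:[:w:]:])) = 0"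
  proof (rule value3_eq_0_imp_eq_0)
    fix x y z :: complex
    show "value3 (X_chi * ((X_chi\<^sup>2 - Const3 (1 / 4)) * (G - [:[:w:]:]))) (x, y, z) = 0"
    proof (cases "x = 0 \<or> x\<^sup>2 = 1 / 4")
      case True
      then show ?thesis by (auto simp: value3.hom_mult value3.hom_minus value3.hom_power)
    next
      case False
      define t where "t = 1 / x"
      have x: "x \<noteq> 0" "x\<^sup>2 \<noteq> 1 / 4" using False by auto
      have t: "t * (t\<^sup>2 - 4) \<noteq> 0"
        using x by (simp add: t_def power_divide field_simps)
      have co: "original_coords t (z * (t\<^sup>2 - 4) / (4 * t)) (y * (t\<^sup>2 - 4) / (4 * t)) = (x, y, z)" for y z
        using t by (simp add: original_coords_def t_def)
      have "(t * (t\<^sup>2 - 4)) ^ n * value3 G (x, y, z) = (t * (t\<^sup>2 - 4)) ^ n * value3 G (x, 0, 0)"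
        using eq[OF t, of "z * (t\<^sup>2 - 4) / (4 * t)" "y * (t\<^sup>2 - 4) / (4 * t)"] eq[OF t, of 0 0]
          co[where y = y and z = z] co[of 0 0] by (simp add: r value3_eq_poly)
      then have "value3 G (x, y, z) = value3 G (x, 0, 0)" using t by simp
      also have "\<dots> = value3 [:[:w:]:] (x, y, z)" by (simp add: value3_eq_poly w_def)
      finally show ?thesis by (simp add: value3.hom_mult value3.hom_minus)
    qed
  qed
  moreover have "X_chi \<noteq> 0" by (simp add: X_chi_def)
  moreover have "X_chi\<^sup>2 - Const3 (1 / 4) \<noteq> 0"
  proof
    assume "X_chi\<^sup>2 - Const3 (1 / 4) = 0"
    then have "value3 (X_chi\<^sup>2 - Const3 (1 / 4)) (0, 0, 0) = 0" by simp
    then show False by (simp add: value3.hom_minus value3.hom_power)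
  qed
  ultimately have "G = [:[:w:]:]" by simp
  then show thesis by (rule that)
qed

section \<open>Irreducibility of the determinants and their surfaces\<close>

lemma value3_rev_mat:
  "value3 (det (rev_mat n (Const3 c) X_chi)) (x, y, z) = det (rev_mat n c x)"
  "value3 (det (rev_mat n (Const3 c) (- X_chi))) (x, y, z) = det (rev_mat n c (- x))"
proof -
  have "map_mat (\<lambda>p. value3 p (x, y, z)) (rev_mat n (Const3 c) h) = rev_mat n c (value3 h (x, y, z))" for h
    by (rule eq_matI) (simp_all add: rev_mat_def value3.hom_add)
  then show "value3 (det (rev_mat n (Const3 c) X_chi)) (x, y, z) = det (rev_mat n c x)"
    "value3 (det (rev_mat n (Const3 c) (- X_chi))) (x, y, z) = det (rev_mat n c (- x))"
    by (simp_all add: value3.hom_det[symmetric] value3.hom_uminus)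
qed

text \<open>The first identity is the reduction of the determinant multiplied by \<open>T\<close>,
  which turns the determinant of the conjugate operation into a power of \<open>\<delta>\<close>.
  The second shows that \<open>T\<close> contributes only factors in \<open>t\<close>.\<close>

lemma factor_relation:
  fixes t \<sigma> b :: complex
  defines "v \<equiv> original_coords t \<sigma> b"
  assumes T_def: "T = det (rev_mat (Suc l) (Const3 (1 / 2)) X_chi)"
    and l: "l \<ge> 1" and FG: "F * G = P_plus l" and t: "t * (t\<^sup>2 - 4) \<noteq> 0"
  shows "value3 F v * value3 G v * det (rev_mat l 0 1) * (t\<^sup>2 - 4) ^ l =
      (4 * t) ^ l * value3 (reduced_poly l) (t, \<sigma>, b) *
        value3 T v"
    and "value3 T v * value3 (det (rev_mat (Suc l) (Const3 (1 / 2)) (- X_chi))) v * (4 * t\<^sup>2) ^ Suc l =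
      (t\<^sup>2 - 4) ^ Suc l"
proof -
  define x y z where "x = 1 / t" "y = 4 * t * b / (t\<^sup>2 - 4)" "z = 4 * t * \<sigma> / (t\<^sup>2 - 4)"
  have v: "v = (x, y, z)" by (simp add: v_def original_coords_def x_y_z_def)
  define \<delta> where "\<delta> = 1 / 4 - x\<^sup>2"
  have t0: "t \<noteq> 0" "t\<^sup>2 - 4 \<noteq> 0" using t by auto
  have x: "x \<noteq> 0" "1 / x = t" using t0 by (simp_all add: x_y_z_def)
  have \<delta>: "\<delta> = (t\<^sup>2 - 4) / (4 * t\<^sup>2)"
    using t0 by (simp add: \<delta>_def x_y_z_def power_divide diff_divide_distrib)
  then have \<delta>0: "\<delta> \<noteq> 0" and \<delta>4: "\<delta> * (4 * t\<^sup>2) = t\<^sup>2 - 4" using t0 by simp_all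
  have "z * \<delta> / x = \<sigma>" "y * \<delta> / x = b"
    unfolding \<delta> using t0 by (simp_all add: x_y_z_def power2_eq_square)
  then have 1: "value3 F v * value3 G v * det (rev_mat (Suc l) (1 / 2) (- x)) * det (rev_mat l 0 1) =
      \<delta> * x ^ l * value3 (reduced_poly l) (t, \<sigma>, b)"
    using det_P_mat_reduced[OF x(1), of l y z] value3_P_plus[OF l, of x y z] x(2)
    unfolding FG[symmetric] by (simp add: v value3_reduced_poly value3.hom_mult \<delta>_def)
  have 2: "det (rev_mat (Suc l) (1 / 2) x) * det (rev_mat (Suc l) (1 / 2) (- x)) = \<delta> ^ Suc l"
    unfolding det_rev_mat_mult by (simp add: \<delta>_def power_divide)
  define f r m p q where "f = value3 F v * value3 G v" "r = det (rev_mat l 0 (1::complex))"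
    "m = det (rev_mat (Suc l) (1 / 2) (- x))" "p = det (rev_mat (Suc l) (1 / 2) x)"
    "q = value3 (reduced_poly l) (t, \<sigma>, b)"
  note rel1 = 1[folded f_r_m_p_q_def] and rel2 = 2[folded f_r_m_p_q_def]
  \<comment> \<open>The product \<open>p * m\<close> is \<open>\<delta> ^ Suc l\<close>; one factor
    \<open>\<delta>\<close> cancels against that of the reduction.\<close>
  have "\<delta> * (f * r * \<delta> ^ l) = f * r * (p * m)"
    unfolding rel2 by simp
  also have "\<dots> = f * m * r * p" by (simp only: mult_ac)
  also have "\<dots> = \<delta> * (x ^ l * q * p)" unfolding rel1 by (simp only: mult_ac)
  finally have "f * r * \<delta> ^ l = x ^ l * q * p" using \<delta>0 by simp
  then have "(f * r * \<delta> ^ l) * (4 * t\<^sup>2) ^ l = (x ^ l * q * p) * (4 * t\<^sup>2) ^ l" by simp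
  then have "f * r * (\<delta> * (4 * t\<^sup>2)) ^ l = (x * (4 * t\<^sup>2)) ^ l * q * p"
    by (simp only: power_mult_distrib mult_ac)
  moreover have "x * (4 * t\<^sup>2) = 4 * t" using t0 by (simp add: x_y_z_def power2_eq_square)
  ultimately have "f * r * (t\<^sup>2 - 4) ^ l = (4 * t) ^ l * q * p"
    by (simp only: \<delta>4)
  then show "value3 F v * value3 G v * det (rev_mat l 0 1) * (t\<^sup>2 - 4) ^ l =
      (4 * t) ^ l * value3 (reduced_poly l) (t, \<sigma>, b) * value3 T v"
    by (simp only: f_r_m_p_q_def v T_def value3_rev_mat)
  have "p * m * (4 * t\<^sup>2) ^ Suc l = (\<delta> * (4 * t\<^sup>2)) ^ Suc l"
    unfolding rel2 by (simp only: power_mult_distrib)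
  then show "value3 T v * value3 (det (rev_mat (Suc l) (Const3 (1 / 2)) (- X_chi))) v * (4 * t\<^sup>2) ^ Suc l =
      (t\<^sup>2 - 4) ^ Suc l"
    by (simp only: \<delta>4 f_r_m_p_q_def v T_def value3_rev_mat)
qed

text \<open>After clearing denominators, the prime polynomial \<^term>\<open>reduced_poly l\<close> divides the
  transform of one factor, so the transform of the other one can only involve \<open>t\<close>.\<close>

lemma factor_of_P_plus_constant_coordinates:
  assumes l: "l \<ge> 1" and FG: "F * G = P_plus l"
  shows "\<exists>w. F = [:[:w:]:] \<or> G = [:[:w:]:]"
proof -
  let ?T = "det (rev_mat (Suc l) (Const3 (1 / 2)) X_chi)"
  let ?T' = "det (rev_mat (Suc l) (Const3 (1 / 2)) (- X_chi))"
  let ?d = "\<lambda>t::complex. t * (t\<^sup>2 - 4)"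
  let ?Q = "reduced_poly l"
  define E where "E = X_chi\<^sup>2 - Const3 4"
  define D where "D = X_chi * E"
  define r where "r = det (rev_mat l 0 (1::complex))"
  have r0: "r \<noteq> 0" unfolding r_def by (rule det_rev_mat_0_1)
  have vals: "value3 E (t, \<sigma>, b) = t\<^sup>2 - 4" "value3 D (t, \<sigma>, b) = ?d t" for t \<sigma> b
    by (simp_all add: E_def D_def value3.hom_mult value3.hom_minus value3.hom_power)
  have "E = [:[:[:- 4, 0, 1:]:]:]"
    by (simp add: E_def X_chi_def Const3_def power2_eq_square)
  then have chiE: "chi_poly E" by (auto simp: chi_poly_def)
  have chiX: "chi_poly X_chi" by (auto simp: chi_poly_def X_chi_def)
  have chiC: "chi_poly (Const3 c)" if "c \<noteq> 0" for c
    using that by (auto simp: chi_poly_def Const3_def)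
  have chiD: "chi_poly D" using chiE chiX by (simp add: D_def chi_poly_mult_iff)
  then have D0: "D \<noteq> 0" by (auto simp: chi_poly_def)
  obtain nF F' where F': "\<And>t \<sigma> b. ?d t \<noteq> 0 \<Longrightarrow>
      ?d t ^ nF * value3 F (original_coords t \<sigma> b) = value3 F' (t, \<sigma>, b)"
    using original_coords_clear_denominators[of F] by blast
  obtain nG G' where G': "\<And>t \<sigma> b. ?d t \<noteq> 0 \<Longrightarrow>
      ?d t ^ nG * value3 G (original_coords t \<sigma> b) = value3 G' (t, \<sigma>, b)"
    using original_coords_clear_denominators[of G] by blast
  obtain nT T where T: "\<And>t \<sigma> b. ?d t \<noteq> 0 \<Longrightarrow>
      ?d t ^ nT * value3 ?T (original_coords t \<sigma> b) = value3 T (t, \<sigma>, b)"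
    using original_coords_clear_denominators[of ?T] by blast
  obtain nS S where S: "\<And>t \<sigma> b. ?d t \<noteq> 0 \<Longrightarrow>
      ?d t ^ nS * value3 ?T' (original_coords t \<sigma> b) = value3 S (t, \<sigma>, b)"
    using original_coords_clear_denominators[of ?T'] by blast
  have cancel_D: "p = q" if "\<And>t \<sigma> b. ?d t \<noteq> 0 \<Longrightarrow> value3 p (t, \<sigma>, b) = value3 q (t, \<sigma>, b)" for p q
  proof -
    have "D * (p - q) = 0"
    proof (rule value3_eq_0_imp_eq_0)
      fix t \<sigma> b
      show "value3 (D * (p - q)) (t, \<sigma>, b) = 0"
        using that[of t \<sigma> b] vals(2)[of t \<sigma> b]
        by (cases "?d t = 0") (simp_all add: value3.hom_mult value3.hom_minus)
    qed
    then show ?thesis using D0 by simp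
  qed
  \<comment> \<open>\<open>T\<close> divides a polynomial in \<open>t\<close> alone, hence is one
    itself.\<close>
  have "T * S * (Const3 4 * X_chi\<^sup>2) ^ Suc l = D ^ (nT + nS) * E ^ Suc l"
  proof (rule cancel_D)
    fix t \<sigma> b :: complex assume t: "?d t \<noteq> 0"
    have "value3 T (t, \<sigma>, b) * value3 S (t, \<sigma>, b) * (4 * t\<^sup>2) ^ Suc l = ?d t ^ (nT + nS) *
        (value3 ?T (original_coords t \<sigma> b) * value3 ?T' (original_coords t \<sigma> b) * (4 * t\<^sup>2) ^ Suc l)"
      unfolding T[OF t, symmetric] S[OF t, symmetric] power_add by (simp only: mult_ac)
    also have "\<dots> = ?d t ^ (nT + nS) * (t\<^sup>2 - 4) ^ Suc l"
      unfolding factor_relation(2)[OF refl l FG t] ..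
    finally show "value3 (T * S * (Const3 4 * X_chi\<^sup>2) ^ Suc l) (t, \<sigma>, b) =
        value3 (D ^ (nT + nS) * E ^ Suc l) (t, \<sigma>, b)"
      by (simp only: value3.hom_mult value3.hom_power vals value3_gens)
  qed
  moreover have "chi_poly (D ^ (nT + nS) * E ^ Suc l)"
    using chiD chiE chi_poly_power by (simp only: chi_poly_mult_iff)
  ultimately have "chi_poly (T * S * (Const3 4 * X_chi\<^sup>2) ^ Suc l)" by simp
  then have chiT: "chi_poly T" by (simp only: chi_poly_mult_iff)
  define U where "U = D ^ nT * Const3 r * E ^ l"
  define W where "W = (Const3 4 * X_chi) ^ l * T * D ^ (nF + nG)"
  have chiU: "chi_poly U" and chiW: "chi_poly W"
    by (simp_all add: U_def W_def chi_poly_mult_iff chi_poly_power chiD chiE chiT chiX chiC r0)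
  have rel: "F' * G' * U = ?Q * W"
  proof (rule cancel_D)
    fix t \<sigma> b :: complex assume t: "?d t \<noteq> 0"
    let ?v = "original_coords t \<sigma> b"
    have "value3 F' (t, \<sigma>, b) * value3 G' (t, \<sigma>, b) * (?d t ^ nT * r * (t\<^sup>2 - 4) ^ l) =
        ?d t ^ (nF + nG) * ?d t ^ nT * (value3 F ?v * value3 G ?v * r * (t\<^sup>2 - 4) ^ l)"
      unfolding F'[OF t, symmetric] G'[OF t, symmetric] power_add by (simp only: mult_ac)
    also have "\<dots> = ?d t ^ (nF + nG) * ?d t ^ nT * ((4 * t) ^ l * value3 ?Q (t, \<sigma>, b) * value3 ?T ?v)"
      unfolding r_def factor_relation(1)[OF refl l FG t] ..
    also have "\<dots> = value3 ?Q (t, \<sigma>, b) * ((4 * t) ^ l * value3 T (t, \<sigma>, b) * ?d t ^ (nF + nG))"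
      unfolding T[OF t, symmetric] by (simp only: mult_ac)
    finally show "value3 (F' * G' * U) (t, \<sigma>, b) = value3 (?Q * W) (t, \<sigma>, b)"
      by (simp only: U_def W_def value3.hom_mult value3.hom_power vals value3_gens)
  qed
  have Q0: "?Q \<noteq> 0" using irreducible_reduced_poly[OF l] by auto
  \<comment> \<open>Cancelling \<open>?Q\<close> leaves \<open>q\<close> as a divisor of
    \<open>W\<close>.\<close>
  have key: "chi_poly q" if pq: "p * q * U = ?Q * W" "?Q dvd p" for p q
  proof -
    obtain K where "p = ?Q * K" using pq(2) by (elim dvdE)
    then have "?Q * (K * q * U) = ?Q * W" using pq(1) by (simp only: mult_ac)
    then have "K * q * U = W" using Q0 by simp
    then show ?thesis using chiW chi_poly_mult_iff by metis
  qed
  have "?Q dvd F' * G' * U" unfolding rel by simp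
  then have "?Q dvd F' * G'" by (rule reduced_poly_dvd_chi_poly_mult[OF l chiU])
  then have "?Q dvd F' \<or> ?Q dvd G'"
    using irreducible_imp_prime_elem[OF irreducible_reduced_poly[OF l]] prime_elem_dvd_mult_iff
    by blast
  then show ?thesis
  proof
    assume "?Q dvd F'"
    then have "chi_poly G'" by (rule key[OF rel])
    then show ?thesis using chi_poly_if_cleared[of G' nG G] G' by metis
  next
    assume "?Q dvd G'"
    moreover have "G' * F' * U = ?Q * W" using rel by (simp only: mult_ac)
    ultimately have "chi_poly F'" using key by blast
    then show ?thesis using chi_poly_if_cleared[of F' nF F] F' by metis
  qed
qed

text \<open>A root of \<open>w\<close> would make the determinant vanish on a whole plane of
  constant \<open>\<chi>\<close>. The axis \<open>a = s = 0\<close> allows only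
  \<open>\<chi> = 0\<close>, which the line \<open>\<chi> = a = 0\<close> rules out.\<close>

lemma chi_factor_of_P_plus_unit:
  assumes l: "l \<ge> 1" and FG: "[:[:w:]:] * G = P_plus l"
  shows "[:[:w:]:] dvd (1 :: poly3)"
proof -
  have P: "poly w x * value3 G (x, y, z) = det (P_mat l x y z)" for x y z
    using value3_P_plus[OF l, of x y z] unfolding FG[symmetric] value3.hom_mult
    by (simp add: value3_eq_poly)
  obtain c where c: "c \<noteq> 0" "\<And>\<chi>. det (P_mat l \<chi> 0 0) = c * \<chi>"
    using det_P_mat_axis[OF l] by blast
  have "poly w x \<noteq> 0" for x
  proof
    assume x: "poly w x = 0"
    then have "x = 0" using P[of x 0 0] c by simp
    then show False using P[of 0 0 1] det_P_mat_origin_line[of 1 l] x by simp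
  qed
  then have "constant (poly w)" using fundamental_theorem_of_algebra by blast
  then obtain u where u: "w = [:u:]" by (metis constant_degree degree_eq_zeroE)
  moreover have "u \<noteq> 0" using \<open>\<And>x. poly w x \<noteq> 0\<close>[of 0] u by simp
  ultimately show ?thesis
    by (intro dvdI[of _ _ "[:[:[:1 / u:]:]:]"]) (simp add: one_pCons)
qed

lemma irreducible_P_plus:
  assumes l: "l \<ge> 1"
  shows "irreducible (P_plus l)"
proof (rule irreducibleI)
  have nz: "value3 (P_plus l) (0, 0, 1) \<noteq> 0"
    by (simp add: value3_P_plus[OF l] det_P_mat_origin_line)
  then show "P_plus l \<noteq> 0" by auto
  obtain c where "\<And>\<chi>. det (P_mat l \<chi> 0 0) = c * \<chi>"
    using det_P_mat_axis[OF l] by blast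
  then have z: "value3 (P_plus l) (0, 0, 0) = 0" by (simp add: value3_P_plus[OF l])
  show "\<not> P_plus l dvd 1"
  proof
    assume "P_plus l dvd 1"
    then obtain k where "1 = P_plus l * k" by (elim dvdE)
    then have "value3 (P_plus l * k) (0, 0, 0) = 1" by (metis value3.hom_one)
    then show False using z by (simp add: value3.hom_mult)
  qed
  fix F G assume P: "P_plus l = F * G"
  obtain w where "F = [:[:w:]:] \<or> G = [:[:w:]:]"
    using factor_of_P_plus_constant_coordinates[OF l P[symmetric]] by blast
  then show "F dvd 1 \<or> G dvd 1"
    using chi_factor_of_P_plus_unit[OF l, of w F] chi_factor_of_P_plus_unit[OF l, of w G] P
    by (metis mult.commute)
qed

lemma value3_sign_subst:
  "value3 (subst3 p (- X_chi) (- X_a) X_s) v = value3 p (sign_involution v)"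
  by (cases v) (simp add: value3_subst3 value3.hom_uminus sign_involution_def)

lemma sign_subst_involutive:
  "subst3 (subst3 p (- X_chi) (- X_a) X_s) (- X_chi) (- X_a) X_s = p"
  by (rule iffD1[OF value3_eq_iff]) (simp add: fun_eq_iff value3_sign_subst sign_involution_def)

lemma irreducible_sign_subst:
  assumes "irreducible p"
  shows "irreducible (subst3 p (- X_chi) (- X_a) X_s)"
proof (rule irreducibleI)
  let ?h = "\<lambda>p. subst3 p (- X_chi) (- X_a) X_s"
  have inv: "?h (?h q) = q" for q by (rule sign_subst_involutive)
  have dvd: "?h q dvd 1 \<longleftrightarrow> q dvd 1" for q
  proof -
    have "?h q dvd 1" if "q dvd 1" for q
      using subst3.hom_dvd[OF that] by (simp add: subst3.hom_one)
    then show ?thesis using inv by metis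
  qed
  show "?h p \<noteq> 0" using assms inv[of p] by (metis not_irreducible_zero subst3.hom_zero)
  show "\<not> ?h p dvd 1" unfolding dvd using assms by (simp add: irreducible_def)
  fix a b assume "?h p = a * b"
  then have "p = ?h a * ?h b" using inv[of p] by (simp add: subst3.hom_mult)
  then have "?h a dvd 1 \<or> ?h b dvd 1" using irreducibleD[OF assms] by blast
  then show "a dvd 1 \<or> b dvd 1" by (simp only: dvd)
qed

lemma P_minus_eq_sign_subst:
  assumes "l \<ge> 1"
  shows "P_minus l = subst3 (P_plus l) (- X_chi) (- X_a) X_s"
  by (rule iffD1[OF value3_eq_iff])
    (auto simp: fun_eq_iff value3_sign_subst sign_involution_def
      value3_P_plus[OF assms] value3_P_minus[OF assms])

section \<open>A curve on both surfaces and their dimension\<close>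

text \<open>The curve on which the last two rows are dependent. Its equations are preserved up to
  sign by the involution, so it lies on both surfaces and serves as the middle member of a
  chain.\<close>

definition common_curve :: "nat \<Rightarrow> (complex \<times> complex \<times> complex) set" where
  "common_curve l = zero_locus {X_s, (Const3 (1 / 4) - X_chi\<^sup>2) * X_a + of_nat l * X_chi}"

lemma mem_common_curve:
  "(\<chi>, a, s) \<in> common_curve l \<longleftrightarrow> s = 0 \<and> (1 / 4 - \<chi>\<^sup>2) * a + of_nat l * \<chi> = 0"
  by (simp add: common_curve_def zero_locus_def value3.hom_add value3.hom_mult value3.hom_minus
      value3.hom_power value3.hom_of_nat)

lemma irreducible_common_curve:
  assumes l: "l \<ge> 1"
  shows "irreducible_algebraic_set (common_curve l)"
proof (rule irreducible_algebraic_setI)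
  show "algebraic_set (common_curve l)"
    unfolding common_curve_def algebraic_set_def by blast
  have "(0, 0, 0) \<in> common_curve l" by (simp add: mem_common_curve)
  then show "common_curve l \<noteq> {}" by blast
  define d where "d = [:1 / 4, 0, - 1 :: complex:]"
  have d: "poly d u = 1 / 4 - u\<^sup>2" for u by (simp add: d_def power2_eq_square)
  have param: "v \<in> common_curve l \<longleftrightarrow> (\<exists>u. poly d u \<noteq> 0 \<and> v = (u, - of_nat l * u / poly d u, 0))" for v
  proof (cases v)
    case (fields \<chi> a s)
    show ?thesis
    proof
      assume "v \<in> common_curve l"
      then have e: "s = 0" "poly d \<chi> * a + of_nat l * \<chi> = 0"
        by (simp_all add: fields mem_common_curve d)
      \<comment> \<open>At a zero of \<open>d\<close> the equation would force
        \<open>\<chi> = 0\<close>, where \<open>d\<close> is 1/4. So \<open>\<chi>\<close>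
        parametrizes the whole curve.\<close>
      have "poly d \<chi> \<noteq> 0"
      proof
        assume d0: "poly d \<chi> = 0"
        then have "of_nat l * \<chi> = 0" using e(2) by simp
        then have "\<chi> = 0" using l by simp
        then show False using d0 by (simp add: d)
      qed
      moreover have "a = - of_nat l * \<chi> / poly d \<chi>"
        using e(2) calculation by (simp add: field_simps add_eq_0_iff)
      ultimately show "\<exists>u. poly d u \<noteq> 0 \<and> v = (u, - of_nat l * u / poly d u, 0)"
        using e(1) fields by blast
    next
      assume "\<exists>u. poly d u \<noteq> 0 \<and> v = (u, - of_nat l * u / poly d u, 0)"
      then show "v \<in> common_curve l" by (auto simp: mem_common_curve d[symmetric])
    qed
  qed
  fix f g assume fg: "\<And>v. v \<in> common_curve l \<Longrightarrow> value3 f v * value3 g v = 0"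
  have "(\<forall>u. poly d u \<noteq> 0 \<longrightarrow> value3 f (u, - of_nat l * u / poly d u, 0) = 0) \<or>
    (\<forall>u. poly d u \<noteq> 0 \<longrightarrow> value3 g (u, - of_nat l * u / poly d u, 0) = 0)"
  proof (rule value3_on_rational_curve)
    show "d \<noteq> 0" by (simp add: d_def)
    show "poly d u * u = poly (d * [:0, 1:]) u" for u by simp
    show "poly d u * (- of_nat l * u / poly d u) = poly [:0, - of_nat l:] u" if "poly d u \<noteq> 0" for u
      using that by simp
    show "poly d u * 0 = poly 0 u" for u by simp
    show "value3 f (u, - of_nat l * u / poly d u, 0) * value3 g (u, - of_nat l * u / poly d u, 0) = 0"
      if "poly d u \<noteq> 0" for u
      using that by (intro fg) (auto simp: param)
  qed
  then show "(\<forall>v\<in>common_curve l. value3 f v = 0) \<or> (\<forall>v\<in>common_curve l. value3 g v = 0)"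
    by (auto simp: param)
qed

lemma irreducible_affine_surface_P:
  assumes l: "l \<ge> 1" and irr: "irreducible p"
    and axis: "c \<noteq> 0" "\<And>x. value3 p (x, 0, 0) = c * x"
    and line: "\<And>z. z \<noteq> 0 \<Longrightarrow> value3 p (0, 0, z) \<noteq> 0"
    and curve: "\<And>v. v \<in> common_curve l \<Longrightarrow> value3 p v = 0"
  shows "irreducible_affine_surface (zero_locus {p})"
proof (rule irreducible_affine_surface_hypersurface[OF irr])
  show deg: "degree p > 0"
  proof (rule ccontr)
    assume "\<not> degree p > 0"
    then obtain p0 where "p = [:p0:]" by (metis degree_eq_zeroE gr0I)
    then have "value3 p (0, 0, 1) = value3 p (0, 0, 0)" by (simp add: value3_eq_poly)
    then show False using line[of 1] axis(2)[of 0] by simp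
  qed
  show "irreducible_algebraic_set (common_curve l)"
    using l by (rule irreducible_common_curve)
  show "(0, 0, 0) \<in> common_curve l" by (simp add: mem_common_curve)
  have "(1, 4 / 3 * of_nat l, 0) \<in> common_curve l" by (simp add: mem_common_curve)
  then show "common_curve l \<noteq> {(0, 0, 0)}" by auto
  let ?h = "(Const3 (1 / 4) - X_chi\<^sup>2) * X_a + of_nat l * X_chi"
  \<comment> \<open>Otherwise \<open>?h = p * K\<close>. On the line \<open>\<chi> = a = 0\<close>
    the left side vanishes and \<open>p\<close> does not off the origin, so \<open>K\<close> is zero
    at the origin; on the axis \<open>a = s = 0\<close> comparison gives
    \<open>c * K = l\<close>.\<close>
  have "common_curve l \<noteq> zero_locus {p}"
  proof
    assume eq: "common_curve l = zero_locus {p}"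
    have "p dvd ?h"
    proof (rule algebraic_hypersurface_dvd[OF irr deg])
      fix v assume "value3 p v = 0"
      then have "v \<in> common_curve l" by (simp add: eq zero_locus_def)
      then show "value3 ?h v = 0" by (simp add: common_curve_def zero_locus_def)
    qed
    then obtain K where K: "?h = p * K" by (elim dvdE)
    have val: "(1 / 4 - x\<^sup>2) * y + of_nat l * x = value3 p (x, y, z) * value3 K (x, y, z)" for x y z
      unfolding value3.hom_mult[symmetric] K[symmetric]
      by (simp add: value3.hom_add value3.hom_mult value3.hom_minus value3.hom_power value3.hom_of_nat)
    \<comment> \<open>A line is a rational curve with denominator 1; this extends the vanishing of
      \<open>K\<close> to the origin.\<close>
    have "(\<forall>u. poly 1 u \<noteq> (0::complex) \<longrightarrow> value3 p (0, 0, u) = 0) \<or>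
        (\<forall>u. poly 1 u \<noteq> (0::complex) \<longrightarrow> value3 K (0, 0, u) = 0)"
    proof (rule value3_on_rational_curve)
      show "poly 1 u * 0 = poly 0 u" "poly 1 u * 0 = poly 0 u" "poly 1 u * u = poly [:0, 1:] u"
        for u :: complex by simp_all
      show "value3 p (0, 0, u) * value3 K (0, 0, u) = 0" for u
        using val[of 0 0 u] by simp
    qed simp
    then have "value3 K (0, 0, 0) = 0" using line[of 1] by auto
    moreover
    define M where "M = Const3 c * K - of_nat l"
    have "(\<forall>u. poly 1 u \<noteq> (0::complex) \<longrightarrow> value3 X_chi (u, 0, 0) = 0) \<or>
        (\<forall>u. poly 1 u \<noteq> (0::complex) \<longrightarrow> value3 M (u, 0, 0) = 0)"
    proof (rule value3_on_rational_curve)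
      show "poly 1 u * u = poly [:0, 1:] u" "poly 1 u * 0 = poly 0 u" "poly 1 u * 0 = poly 0 u"
        for u :: complex by simp_all
      show "value3 X_chi (u, 0, 0) * value3 M (u, 0, 0) = 0" for u
        using val[of u 0 0] axis(2)[of u]
        by (auto simp: M_def value3.hom_mult value3.hom_minus value3.hom_of_nat)
    qed simp
    then have "value3 M (0, 0, 0) = 0" by (auto dest: spec[of _ 1])
    ultimately show False using l
      by (simp add: M_def value3.hom_mult value3.hom_minus value3.hom_of_nat)
  qed
  then show "common_curve l \<subset> zero_locus {p}"
    using curve by (auto simp: zero_locus_def)
qed

theorem theorem1p13:
  fixes l :: nat
  assumes "l \<ge> 1"
  shows "irreducible (P_plus l) \<and> irreducible (P_minus l) \<and>
         P_minus l = subst3 (P_plus l) (- X_chi) (- X_a) X_s \<and>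
         P_plus l = subst3 (P_minus l) (- X_chi) (- X_a) X_s \<and>
         irreducible_affine_surface (S_plus l) \<and>
         irreducible_affine_surface (S_minus l) \<and>
         sign_involution \<circ> sign_involution = id \<and>
         sign_involution ` S_plus l = S_minus l \<and>
         sign_involution ` S_minus l = S_plus l"
proof -
  note l = assms
  have irr_plus: "irreducible (P_plus l)" using l by (rule irreducible_P_plus)
  have minus: "P_minus l = subst3 (P_plus l) (- X_chi) (- X_a) X_s"
    using l by (rule P_minus_eq_sign_subst)
  then have irr_minus: "irreducible (P_minus l)" using irr_plus irreducible_sign_subst by simp
  have plus: "P_plus l = subst3 (P_minus l) (- X_chi) (- X_a) X_s"
    unfolding minus sign_subst_involutive ..
  obtain c where c: "c \<noteq> 0" "\<And>\<chi>. det (P_mat l \<chi> 0 0) = c * \<chi>"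
    using det_P_mat_axis[OF l] by blast
  note val = value3_P_plus[OF l] value3_P_minus[OF l]
  have surf_plus: "irreducible_affine_surface (S_plus l)"
    unfolding S_plus_def
  proof (rule irreducible_affine_surface_P[OF l irr_plus c(1)])
    show "value3 (P_plus l) v = 0" if "v \<in> common_curve l" for v
      using that det_P_mat_curve[OF l] by (cases v) (auto simp: mem_common_curve val)
  qed (simp_all add: val c det_P_mat_origin_line)
  have surf_minus: "irreducible_affine_surface (S_minus l)"
    unfolding S_minus_def
  proof (rule irreducible_affine_surface_P[OF l irr_minus])
    \<comment> \<open>On the axis the sign change replaces \<open>\<chi>\<close> by
      \<open>- \<chi>\<close>, so the slope becomes \<open>- c\<close>.\<close>
    show "- c \<noteq> 0" using c(1) by simp
    show "value3 (P_minus l) v = 0" if "v \<in> common_curve l" for v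
    proof (cases v)
      case (fields \<chi> a s)
      then have "s = 0" "(1 / 4 - (- \<chi>)\<^sup>2) * (- a) + of_nat l * (- \<chi>) = 0"
        using that by (auto simp: mem_common_curve algebra_simps add_eq_0_iff)
      then show ?thesis using det_P_mat_curve[OF l] by (simp add: fields val)
    qed
  qed (simp_all add: val c det_P_mat_origin_line)
  have inv: "sign_involution (sign_involution v) = v" for v
    by (cases v) (simp add: sign_involution_def)
  have S: "sign_involution v \<in> S_minus l \<longleftrightarrow> v \<in> S_plus l" for v
    by (simp add: S_plus_def S_minus_def zero_locus_def minus value3_sign_subst inv)
  have S': "sign_involution v \<in> S_plus l \<longleftrightarrow> v \<in> S_minus l" for v
    using S[of "sign_involution v"] by (simp add: inv)
  have img: "sign_involution ` A = {v. sign_involution v \<in> A}" for A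
    by (rule Set.set_eqI) (metis image_iff inv mem_Collect_eq)
  have "sign_involution ` S_plus l = S_minus l" "sign_involution ` S_minus l = S_plus l"
    unfolding img S S' by simp_all
  moreover have "sign_involution \<circ> sign_involution = id"
    by (rule ext) (simp add: inv)
  ultimately show ?thesis
    by (intro conjI irr_plus irr_minus minus plus surf_plus surf_minus)
qed

end
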